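(* Let $\rho_n=2^{-1/n}$. (a) Let $n\ge 3$ and let $y\in\mathbf{R}^n$ with $0<|y|\le\rho_n^2$. Then the best harmonic approximant in $L^1(\mathbf{B}_n)$ of the function $f(x)=\dfrac{1}{|x-y|^{n-2}}$ is the function $$h(x)=\left(\frac{\rho_n}{|y|}\right)^{n-2}\frac{1}{|x-y'|^{n-2}}.$$ (b) Let $n=2$ and let $y\in\mathbf{R}^2$ with $0<|y|\le\frac12$. Then the best approximant in $L^1_h(\mathbf{D})$ of the function $f(x)=\log|x-y|$ is the function $$h(x)=\log\left(\sqrt2\,|y|\,|x-y'|\right).$$ (c) When $y=0$, the best harmonic approximants (of $|x|^{-(n-2)}$ on $\mathbf{B}_n$ for $n\ge3$, and of $\log|x|$ on $\mathbf{D}$ for $n=2$) are the constant functions $\rho_n^{-(n-2)}$ and $\log\frac{1}{\sqrt2}$ respectively.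
   Context: $\mathbf{B}_n$ is the open unit ball in $\mathbf{R}^n$ with Lebesgue measure, and $\mathbf{D}=\mathbf{B}_2$. $L^1_h(\mathbf{B}_n)$ is the space of harmonic functions on $\mathbf{B}_n$ that are integrable. A best harmonic approximant in $L^1(\mathbf{B}_n)$ to $f\in L^1(\mathbf{B}_n)$ is an $h\in L^1_h(\mathbf{B}_n)$ minimizing $\|f-h\|_1$ over $L^1_h(\mathbf{B}_n)$. For $y\ne0$ in $\mathbf{R}^n$, $y'$ denotes the reflection of $y$ in the sphere of radius $\rho_n$ centered at $0$: $y'$ lies on the same ray from the origin as $y$ and $|y|\,|y'|=\rho_n^2$. *)

theory Defs
  imports "HOL-Analysis.Analysis"
begin

(* A C^2 function with vanishing Laplacian: g is the gradient of u, H its Hessian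
   matrix, and the trace of H is the Laplacian of u. *)
definition harmonic_on :: "(real^'n) set \<Rightarrow> (real^'n \<Rightarrow> real) \<Rightarrow> bool" where
  "harmonic_on S u \<longleftrightarrow> open S \<and>
     (\<exists>(g :: real^'n \<Rightarrow> real^'n) (H :: real^'n \<Rightarrow> real^'n^'n).
        (\<forall>x\<in>S. (u has_derivative (\<lambda>v. g x \<bullet> v)) (at x)) \<and>
        (\<forall>x\<in>S. (g has_derivative (\<lambda>v. H x *v v)) (at x)) \<and>
        continuous_on S H \<and>
        (\<forall>x\<in>S. trace (H x) = 0))"

abbreviation unit_ball :: "(real^'n) set" where
  "unit_ball \<equiv> ball 0 1"

definition L1_harmonic :: "(real^'n \<Rightarrow> real) set" where
  "L1_harmonic = {h. harmonic_on unit_ball h \<and> h absolutely_integrable_on unit_ball}"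

definition L1_norm :: "(real^'n \<Rightarrow> real) \<Rightarrow> real" where
  "L1_norm f = (LINT x:unit_ball|lebesgue. \<bar>f x\<bar>)"

definition best_harmonic_approximant ::
    "(real^'n \<Rightarrow> real) \<Rightarrow> (real^'n \<Rightarrow> real) \<Rightarrow> bool" where
  "best_harmonic_approximant f h \<longleftrightarrow>
     f absolutely_integrable_on unit_ball \<and> h \<in> L1_harmonic \<and>
     (\<forall>g\<in>L1_harmonic. L1_norm (\<lambda>x. f x - h x) \<le> L1_norm (\<lambda>x. f x - g x))"

(* Uniqueness is as functions on the ball: elements of L1_harmonic are total functions
   whose values outside the ball are irrelevant. *)
definition the_best_harmonic_approximant ::
    "(real^'n \<Rightarrow> real) \<Rightarrow> (real^'n \<Rightarrow> real) \<Rightarrow> bool" where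
  "the_best_harmonic_approximant f h \<longleftrightarrow>
     best_harmonic_approximant f h \<and>
     (\<forall>g. best_harmonic_approximant f g \<longrightarrow> (\<forall>x\<in>unit_ball. g x = h x))"

definition rho :: "nat \<Rightarrow> real" where
  "rho n = 2 powr (- 1 / real n)"

definition sphere_reflection :: "real \<Rightarrow> real^'n \<Rightarrow> real^'n" where
  "sphere_reflection r y = (r\<^sup>2 / (norm y)\<^sup>2) *\<^sub>R y"

lemma sphere_reflection_unique:
  fixes y y' :: "real^'n"
  assumes "y \<noteq> 0" "r > 0"
  shows "y' = sphere_reflection r y \<longleftrightarrow>
           (\<exists>t>0. y' = t *\<^sub>R y) \<and> norm y * norm y' = r\<^sup>2"
proof
  assume "y' = sphere_reflection r y"
  then show "(\<exists>t>0. y' = t *\<^sub>R y) \<and> norm y * norm y' = r\<^sup>2"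
    using assms by (auto simp: sphere_reflection_def power2_eq_square)
next
  assume R: "(\<exists>t>0. y' = t *\<^sub>R y) \<and> norm y * norm y' = r\<^sup>2"
  then obtain t where t: "t > 0" "y' = t *\<^sub>R y" by blast
  with R assms have "t = r\<^sup>2 / (norm y)\<^sup>2"
    by (simp add: field_simps power2_eq_square)
  with t show "y' = sphere_reflection r y" by (simp add: sphere_reflection_def)
qed

(* The reflection of y in the sphere of radius rho n centred at 0, where n is the dimension. *)
abbreviation rho_reflection :: "real^'n \<Rightarrow> real^'n" where
  "rho_reflection y \<equiv> sphere_reflection (rho CARD('n)) y"

end

theory Submission
  imports Defs
begin

text \<open>
  Let \<open>\<rho>\<close> be the radius whose ball has half the volume of the unit ball, and let \<open>\<sigma>\<close> be \<open>1\<close> on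
  \<open>\<bar>x\<bar> \<le> \<rho>\<close> and \<open>-1\<close> outside. By the mean value property \<open>\<integral> \<sigma> u = 0\<close> for every integrable harmonic
  \<open>u\<close>. Comparing \<open>\<bar>x - y\<bar>\<close> with \<open>(\<bar>y\<bar> / \<rho>) \<bar>x - y'\<bar>\<close> shows that \<open>f - h\<close> has constant sign times \<open>\<sigma>\<close>, so
  \<open>\<parallel>f - h\<parallel> = \<bar>\<integral> \<sigma> (f - g)\<bar> \<le> \<parallel>f - g\<parallel>\<close> for every competitor \<open>g\<close>. Equality forces
  \<open>f - g\<close> to change sign across \<open>\<bar>x\<bar> = \<rho>\<close>, hence \<open>g = f = h\<close> on that sphere and, by the Dirichlet
  principle and unique continuation, everywhere.

  No surface measure is needed: integrals over balls of divergence-free fields are handled by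
  translation invariance of Lebesgue measure, applied to fields that vanish on the boundary. Unique continuation comes from the fact that
  \<open>\<integral> u (r x) u (s x)\<close> over a ball depends only on \<open>r s\<close>.
\<close>

section \<open>Differentiation under the integral sign and translation invariance\<close>

lemma absolutely_integrable_continuous_compact:
  fixes f :: "'a::euclidean_space \<Rightarrow> 'b::euclidean_space"
  assumes "compact S" "continuous_on S f"
  shows "f absolutely_integrable_on S"
  using integrable_completion[of "\<lambda>x. indicator S x *\<^sub>R f x" lborel] borel_integrable_compact[OF assms]
    borel_measurable_integrable[OF borel_integrable_compact[OF assms]]
  unfolding set_integrable_def indicator_scaleR_eq_if by simp

text \<open>Dominated convergence for difference quotients along an arbitrary sequence tending to
  \<open>t0\<close>. The derivative is asked only at \<open>t0\<close> and only off
  \<open>N\<close>, so that functions with a kink along a sphere are covered.\<close>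

lemma has_real_derivative_integral:
  fixes \<phi> :: "real \<Rightarrow> 'a::euclidean_space \<Rightarrow> real"
  assumes "d > 0" and C: "C integrable_on S" and N: "negligible N"
    and int: "\<And>t. \<bar>t - t0\<bar> < d \<Longrightarrow> \<phi> t integrable_on S"
    and der: "\<And>x. x \<in> S - N \<Longrightarrow> ((\<lambda>t. \<phi> t x) has_real_derivative \<phi>' x) (at t0)"
    and lip: "\<And>t x. \<bar>t - t0\<bar> < d \<Longrightarrow> x \<in> S \<Longrightarrow> \<bar>\<phi> t x - \<phi> t0 x\<bar> \<le> C x * \<bar>t - t0\<bar>"
  shows "((\<lambda>t. integral S (\<phi> t)) has_real_derivative integral S \<phi>') (at t0)"
proof -
  have spike: "integral (S - N) f = integral S f" "(f integrable_on (S - N)) = (f integrable_on S)" 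
    for f :: "'a \<Rightarrow> real"
    by (rule integral_spike_set integrable_spike_set_eq; rule negligible_subset[OF N]; auto)+
  have "((\<lambda>t. (integral S (\<phi> t) - integral S (\<phi> t0)) / (t - t0)) \<longlongrightarrow> integral S \<phi>') (at t0)"
    unfolding tendsto_at_iff_sequentially comp_def
  proof (intro allI impI)
    fix X assume X: "\<forall>i. X i \<in> UNIV - {t0}" "X \<longlonglongrightarrow> t0"
    have "\<forall>\<^sub>F i in sequentially. \<bar>X i - t0\<bar> < d"
      using tendstoD[OF X(2) \<open>d > 0\<close>] by (simp add: dist_real_def)
    then obtain k where k: "\<And>i. i \<ge> k \<Longrightarrow> \<bar>X i - t0\<bar> < d"
      unfolding eventually_sequentially by blast
    \<comment> \<open>The domination must hold for every term, so the initial terms, possibly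
      farther than \<open>d\<close> from \<open>t0\<close>, are dropped.\<close>
    define Y where "Y i = X (i + k)" for i
    have Y: "Y \<longlonglongrightarrow> t0" "\<And>i. Y i \<noteq> t0" "\<And>i. \<bar>Y i - t0\<bar> < d"
      using X k LIMSEQ_ignore_initial_segment[OF X(2), of k] unfolding Y_def by auto
    have intY: "(\<lambda>x. (\<phi> (Y i) x - \<phi> t0 x) / (Y i - t0)) integrable_on S" for i
      using int[OF Y(3), of i] int[of t0] \<open>d>0\<close> by (intro integrable_on_divide integrable_diff) auto
    have "(\<lambda>i. integral (S - N) (\<lambda>x. (\<phi> (Y i) x - \<phi> t0 x) / (Y i - t0))) \<longlonglongrightarrow> integral (S - N) \<phi>'"
    proof (rule dominated_convergence(2))
      show "(\<lambda>x. (\<phi> (Y i) x - \<phi> t0 x) / (Y i - t0)) integrable_on (S - N)" for i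
        using intY spike by blast
      show "C integrable_on (S - N)" using C spike by blast
      show "norm ((\<phi> (Y i) x - \<phi> t0 x) / (Y i - t0)) \<le> C x" if "x \<in> S - N" for i x
        using lip[OF Y(3), of x i] that Y(2)[of i] by (simp add: divide_simps abs_divide)
      show "(\<lambda>i. (\<phi> (Y i) x - \<phi> t0 x) / (Y i - t0)) \<longlonglongrightarrow> \<phi>' x" if "x \<in> S - N" for x
        using der[OF that] Y(1,2) unfolding has_field_derivative_iff tendsto_at_iff_sequentially comp_def
        by auto
    qed
    moreover have "integral (S - N) (\<lambda>x. (\<phi> (Y i) x - \<phi> t0 x) / (Y i - t0)) =
       (integral S (\<phi> (Y i)) - integral S (\<phi> t0)) / (Y i - t0)" for i
      using int[OF Y(3), of i] int[of t0] \<open>d>0\<close> by (simp only: spike integral_diff integral_divide)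
    ultimately have "(\<lambda>i. (integral S (\<phi> (X (i+k))) - integral S (\<phi> t0)) / (X (i+k) - t0)) \<longlonglongrightarrow> integral S \<phi>'"
      by (simp only: spike Y_def)
    then show "(\<lambda>i. (integral S (\<phi> (X i)) - integral S (\<phi> t0)) / (X i - t0)) \<longlonglongrightarrow> integral S \<phi>'"
      by (rule LIMSEQ_offset)
  qed
  then show ?thesis unfolding has_field_derivative_iff .
qed

lemma lborel_integrable_translation:
  fixes f :: "'a::euclidean_space \<Rightarrow> real"
  assumes "integrable lborel f"
  shows "integrable lborel (\<lambda>x. f (c + x))" "integral UNIV (\<lambda>x. f (c + x)) = integral UNIV f"
proof -
  have "integrable (distr lborel borel ((+) c)) f"
    using assms by (simp add: lborel_distr_plus)
  then show 1: "integrable lborel (\<lambda>x. f (c + x))"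
    by (rule integrable_distr[rotated]) simp
  have "integral UNIV (\<lambda>x. f (c + x)) = integral\<^sup>L lborel (\<lambda>x. f (c + x))"
    using 1 by (rule integral_lborel)
  also have "\<dots> = integral\<^sup>L (distr lborel borel ((+) c)) f"
    using assms by (subst integral_distr) auto
  also have "\<dots> = integral UNIV f"
    using integral_lborel[OF assms] by (simp add: lborel_distr_plus)
  finally show "integral UNIV (\<lambda>x. f (c + x)) = integral UNIV f" .
qed

section \<open>Divergence theorem on balls for fields vanishing on the boundary\<close>

lemma ball_segment_sphere:
  fixes x e :: "'a::real_normed_vector"
  assumes "norm x \<le> R" "norm (x + t *\<^sub>R e) \<ge> R"
  obtains s where "norm (x + s *\<^sub>R e) = R" "\<bar>s\<bar> \<le> \<bar>t\<bar>"
proof -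
  have "\<exists>c. 0 \<le> c \<and> c \<le> 1 \<and> norm (x + (c * t) *\<^sub>R e) = R"
    using assms by (intro IVT') (auto intro!: continuous_intros)
  then obtain c where c: "0 \<le> c" "c \<le> 1" "norm (x + (c * t) *\<^sub>R e) = R" by blast
  with c that[of "c * t"] show ?thesis 
    by (simp add: abs_mult mult_left_le_one_le)
qed

text \<open>The extension \<open>F\<close> of \<open>f\<close> by zero is Lipschitz along
  \<open>e\<close>, because \<open>f\<close> vanishes on the sphere. The integral of
  \<open>F (x + t *\<^sub>R e)\<close> over \<open>x\<close> does not depend on \<open>t\<close>
  near 0; differentiating it at \<open>t = 0\<close> under the integral gives the claim.\<close>

lemma integral_directional_derivative_zero:
  fixes f :: "'a::euclidean_space \<Rightarrow> real"
  assumes "open U" "cball 0 R \<subseteq> U" and R: "R > 0"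
    and der: "\<And>x. x \<in> U \<Longrightarrow> (f has_derivative f' x) (at x)"
    and cont: "continuous_on U (\<lambda>x. f' x e)"
    and zero: "\<And>x. norm x = R \<Longrightarrow> f x = 0"
  shows "integral (cball 0 R) (\<lambda>x. f' x e) = 0"
proof -
  define F where "F x = (if x \<in> cball 0 R then f x else 0)" for x
  have contf: "continuous_on (cball 0 R) f"
    using der assms(2) by (meson continuous_at_imp_continuous_on has_derivative_continuous subsetD)
  have "bounded ((\<lambda>x. f' x e) ` cball 0 R)"
    using cont assms(2) by (intro compact_imp_bounded compact_continuous_image) (auto intro: continuous_on_subset)
  then obtain C where C: "C > 0" "\<And>x. norm x \<le> R \<Longrightarrow> \<bar>f' x e\<bar> \<le> C"
    unfolding bounded_pos by auto
  have line: "((\<lambda>t. f (x + t *\<^sub>R e)) has_real_derivative f' (x + t *\<^sub>R e) e) (at t within T)" 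
    if "x + t *\<^sub>R e \<in> U" for x t T
  proof -
    have lin: "linear (f' (x + t *\<^sub>R e))" using der[OF that] by (rule has_derivative_linear)
    have "((\<lambda>t. f (x + t *\<^sub>R e)) has_derivative (\<lambda>h. f' (x + t *\<^sub>R e) (h *\<^sub>R e))) (at t within T)"
      by (rule has_derivative_compose[where f="\<lambda>t. x + t *\<^sub>R e", OF _ der[OF that]])
        (auto intro!: derivative_eq_intros)
    then show ?thesis unfolding has_field_derivative_def
      by (simp add: linear_scale[OF lin] mult.commute[of _ "f' _ e"])
  qed
  have in_in: "\<bar>f (x + t *\<^sub>R e) - f x\<bar> \<le> C * \<bar>t\<bar>" if "norm x \<le> R" "norm (x + t *\<^sub>R e) \<le> R" for x t
  proof -
    have "norm (f (x + t *\<^sub>R e) - f (x + 0 *\<^sub>R e)) \<le> C * norm (t - 0)"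
    proof (rule field_differentiable_bound[where S="closed_segment 0 t" and f="\<lambda>t. f (x + t *\<^sub>R e)"
          and f'="\<lambda>t. f' (x + t *\<^sub>R e) e"])
      fix s assume "s \<in> closed_segment 0 t"
      then obtain u where u: "0 \<le> u" "u \<le> 1" "s = u * t" by (auto simp: in_segment)
      have "x + s *\<^sub>R e = (1 - u) *\<^sub>R x + u *\<^sub>R (x + t *\<^sub>R e)"
        by (simp add: u algebra_simps)
      also have "\<dots> \<in> cball 0 R"
        using convexD_alt[OF convex_cball, of x 0 R "x + t *\<^sub>R e" u] that u by (simp add: mem_cball)
      finally have *: "x + s *\<^sub>R e \<in> cball 0 R" .
      show "((\<lambda>t. f (x + t *\<^sub>R e)) has_field_derivative f' (x + s *\<^sub>R e) e) (at s within closed_segment 0 t)"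
        using * assms(2) by (intro line) auto
      show "norm (f' (x + s *\<^sub>R e) e) \<le> C" using C * by auto
    qed auto
    then show ?thesis by simp
  qed
  \<comment> \<open>A segment leaving the ball is cut where it meets the sphere. There
    \<open>f\<close> is zero, so the bound inside the ball controls \<open>f x\<close>
    itself.\<close>
  have in_out: "\<bar>f x\<bar> \<le> C * \<bar>t\<bar>" if xt: "norm x \<le> R" "norm (x + t *\<^sub>R e) \<ge> R" for x t
  proof -
    obtain s where s: "norm (x + s *\<^sub>R e) = R" "\<bar>s\<bar> \<le> \<bar>t\<bar>" using ball_segment_sphere[OF xt] .
    have "\<bar>f (x + s *\<^sub>R e) - f x\<bar> \<le> C * \<bar>s\<bar>" using s that by (intro in_in) auto
    also have "\<dots> \<le> C * \<bar>t\<bar>" using s C by auto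
    finally show ?thesis using zero[OF s(1)] by simp
  qed
  have lip: "\<bar>F (x + t *\<^sub>R e) - F x\<bar> \<le> C * \<bar>t\<bar>" for x t
  proof (cases "norm x \<le> R"; cases "norm (x + t *\<^sub>R e) \<le> R")
    assume "norm x \<le> R" "norm (x + t *\<^sub>R e) \<le> R"
    with in_in[of x t] show ?thesis by (simp add: F_def)
  next
    assume "norm x \<le> R" "\<not> norm (x + t *\<^sub>R e) \<le> R"
    with in_out[of x t] show ?thesis by (simp add: F_def)
  next
    assume "\<not> norm x \<le> R" "norm (x + t *\<^sub>R e) \<le> R"
    have x: "(x + t *\<^sub>R e) + (- t) *\<^sub>R e = x" by simp
    have "norm (x + t *\<^sub>R e + (- t) *\<^sub>R e) \<ge> R"
      unfolding x using \<open>\<not> norm x \<le> R\<close> by simp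
    from in_out[OF \<open>norm (x + t *\<^sub>R e) \<le> R\<close> this]
    have "\<bar>f (x + t *\<^sub>R e)\<bar> \<le> C * \<bar>t\<bar>" by simp
    with \<open>\<not> norm x \<le> R\<close> \<open>norm (x + t *\<^sub>R e) \<le> R\<close> show ?thesis by (simp add: F_def)
  qed (use C in \<open>simp add: F_def\<close>)
  have Fint: "integrable lborel F"
    using borel_integrable_compact[OF compact_cball contf] unfolding F_def indicator_scaleR_eq_if .
  have Fint': "(\<lambda>x. F (x + c)) integrable_on T" if "T \<in> sets lebesgue" for c T
  proof -
    note Fc = lborel_integrable_translation(1)[OF Fint, of c]
    have "integrable lebesgue (\<lambda>x. F (c + x))"
      using Fc integrable_completion borel_measurable_integrable by blast
    then have "(\<lambda>x. F (c + x)) absolutely_integrable_on UNIV"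
      unfolding set_integrable_def by simp
    then have "(\<lambda>x. F (c + x)) absolutely_integrable_on T"
      by (rule set_integrable_subset) (use that in auto)
    then show ?thesis
      unfolding absolutely_integrable_on_def by (simp add: add.commute[of c])
  qed
  \<comment> \<open>For \<bar>t\<bar> < 1 every translate of \<open>F\<close> is supported in
    \<open>S\<close>, whose finite measure makes the constant \<open>C\<close> integrable.\<close>
  define S where "S = cball (0::'a) (R + norm e)"
  have "((\<lambda>t. integral S (\<lambda>x. F (x + t *\<^sub>R e))) has_real_derivative 
      integral S (\<lambda>x. if x \<in> cball 0 R then f' x e else 0)) (at 0)"
  proof (rule has_real_derivative_integral[where d = 1 and C="\<lambda>_. C" and N = "sphere 0 R"])
    fix x assume x: "x \<in> S - sphere 0 R"
    show "((\<lambda>t. F (x + t *\<^sub>R e)) has_real_derivative (if x \<in> cball 0 R then f' x e else 0)) (at 0)"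
    proof (cases "x \<in> cball 0 R")
      case True
      then have "x \<in> ball 0 R" using x by auto
      have "((\<lambda>t. f (x + t *\<^sub>R e)) has_real_derivative f' x e) (at 0)"
        using line[of x 0] True assms(2) by auto
      moreover have "\<forall>\<^sub>F t in nhds 0. x + t *\<^sub>R e \<in> ball 0 R"
        by (rule topological_tendstoD) (use \<open>x \<in> ball 0 R\<close> in \<open>auto intro!: tendsto_eq_intros filterlim_ident\<close>)
      ultimately show ?thesis using True
        by (subst DERIV_cong_ev[OF refl _ refl, where g="\<lambda>t. f (x + t *\<^sub>R e)"])
           (auto simp: F_def elim!: eventually_mono)
    next
      case False
      then have "x \<in> - cball 0 R" using x by auto
      have "\<forall>\<^sub>F t in nhds 0. x + t *\<^sub>R e \<in> - cball 0 R"
        by (rule topological_tendstoD) (use \<open>x \<in> - cball 0 R\<close> in \<open>auto intro!: tendsto_eq_intros filterlim_ident\<close>)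
      then show ?thesis using False
        by (subst DERIV_cong_ev[OF refl _ refl, where g="\<lambda>t. 0"])
           (auto simp: F_def elim!: eventually_mono)
    qed
  next
    show "(\<lambda>x. F (x + t *\<^sub>R e)) integrable_on S" for t
      by (rule Fint') (simp add: S_def)
  qed (use lip in \<open>auto simp: negligible_sphere S_def integrable_on_const\<close>)
  moreover have "integral S (\<lambda>x. F (x + t *\<^sub>R e)) = integral UNIV F" if "\<bar>t\<bar> < 1" for t
  proof -
    have "F (x + t *\<^sub>R e) = 0" if "x \<notin> S" for x
    proof -
      have "norm (t *\<^sub>R e) \<le> norm e" using \<open>\<bar>t\<bar> < 1\<close> by (simp add: mult_left_le_one_le)
      then show ?thesis using that norm_triangle_ineq4[of "x + t *\<^sub>R e" "t *\<^sub>R e"]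
        by (auto simp: F_def S_def)
    qed
    then have "integral S (\<lambda>x. F (x + t *\<^sub>R e)) = integral UNIV (\<lambda>x. F (x + t *\<^sub>R e))"
      by (subst integral_restrict_UNIV[symmetric], intro integral_cong) auto
    then show ?thesis using lborel_integrable_translation(2)[OF Fint, of "t *\<^sub>R e"] by (simp add: add.commute)
  qed
  then have "((\<lambda>t. integral S (\<lambda>x. F (x + t *\<^sub>R e))) has_real_derivative 0) (at 0)"
    by (subst DERIV_cong_ev[OF refl _ refl, where g="\<lambda>t. integral UNIV F"])
       (auto simp: eventually_nhds_metric dist_real_def intro!: exI[of _ 1])
  ultimately have "integral S (\<lambda>x. if x \<in> cball 0 R then f' x e else 0) = 0"
    by (rule DERIV_unique)
  moreover have "integral S (\<lambda>x. if x \<in> cball 0 R then f' x e else 0) = integral (S \<inter> cball 0 R) (\<lambda>x. f' x e)"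
    by (subst Int_commute, rule integral_restrict_Int)
  moreover have "S \<inter> cball 0 R = cball 0 R" unfolding S_def by (auto simp: add_increasing2)
  ultimately show ?thesis by simp
qed

text \<open>Applied to the derivative of a vector field, this is its divergence.\<close>

definition lin_trace :: "('a::euclidean_space \<Rightarrow> 'a) \<Rightarrow> real" where
  "lin_trace L = (\<Sum>b\<in>Basis. L b \<bullet> b)"

lemma lin_trace_add: "lin_trace (\<lambda>v. L v + M v) = lin_trace L + lin_trace M"
  and lin_trace_diff: "lin_trace (\<lambda>v. L v - M v) = lin_trace L - lin_trace M"
  and lin_trace_scaleR: "lin_trace (\<lambda>v. c *\<^sub>R L v) = c * lin_trace L"
  by (simp_all add: lin_trace_def inner_add_left inner_diff_left sum.distrib sum_subtractf sum_distrib_left)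

text \<open>Differentiating the scalar factor of a field contributes a map of this form, hence this
  term in the divergence.\<close>

lemma lin_trace_rank_one: "lin_trace (\<lambda>v. (a \<bullet> v) *\<^sub>R b) = a \<bullet> b"
  by (simp add: lin_trace_def euclidean_inner[of a b])

lemma integral_divergence_zero:
  fixes X :: "'a::euclidean_space \<Rightarrow> 'a"
  assumes U: "open U" "cball 0 R \<subseteq> U" and R: "R > 0"
    and der: "\<And>x. x \<in> U \<Longrightarrow> (X has_derivative D x) (at x)"
    and cont: "\<And>b. b \<in> Basis \<Longrightarrow> continuous_on U (\<lambda>x. D x b)"
    and zero: "\<And>x. norm x = R \<Longrightarrow> X x = 0"
  shows "integral (cball 0 R) (\<lambda>x. lin_trace (D x)) = 0"
proof -
  have "(\<lambda>x. D x b \<bullet> b) integrable_on cball 0 R" if "b \<in> Basis" for b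
    by (intro set_lebesgue_integral_eq_integral(1) absolutely_integrable_continuous_compact
        compact_cball continuous_intros continuous_on_subset[OF cont[OF that] U(2)])
  then have "integral (cball 0 R) (\<lambda>x. lin_trace (D x)) = (\<Sum>b\<in>Basis. integral (cball 0 R) (\<lambda>x. D x b \<bullet> b))"
    unfolding lin_trace_def by (intro integral_sum) auto
  also have "\<dots> = 0"
  proof (intro sum.neutral ballI)
    fix b :: 'a assume b: "b \<in> Basis"
    show "integral (cball 0 R) (\<lambda>x. D x b \<bullet> b) = 0"
    proof (rule integral_directional_derivative_zero[OF U R, where f="\<lambda>x. X x \<bullet> b" and f'="\<lambda>x v. D x v \<bullet> b"])
      show "((\<lambda>x. X x \<bullet> b) has_derivative (\<lambda>v. D x v \<bullet> b)) (at x)" if "x \<in> U" for x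
        using der[OF that] by (auto intro!: derivative_eq_intros)
      show "continuous_on U (\<lambda>x. D x b \<bullet> b)"
        using cont[OF b] by (intro continuous_intros)
    qed (use zero in auto)
  qed
  finally show ?thesis .
qed

text \<open>The divergence theorem for \<open>(R\<^sup>2 - \<bar>x\<bar>\<^sup>2) X\<close>, which vanishes on the boundary and has
  divergence \<open>- 2 x \<bullet> X\<close>, replaces the flux of \<open>X\<close> through spheres.\<close>

lemma integral_radial_part_zero:
  fixes X :: "'a::euclidean_space \<Rightarrow> 'a"
  assumes U: "open U" "cball 0 R \<subseteq> U" and R: "R > 0"
    and der: "\<And>x. x \<in> U \<Longrightarrow> (X has_derivative D x) (at x)"
    and cont: "\<And>b. b \<in> Basis \<Longrightarrow> continuous_on U (\<lambda>x. D x b)"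
    and div: "\<And>x. x \<in> U \<Longrightarrow> lin_trace (D x) = 0"
  shows "integral (cball 0 R) (\<lambda>x. x \<bullet> X x) = 0"
proof -
  have contX: "continuous_on U X"
    using der by (meson continuous_at_imp_continuous_on has_derivative_continuous)
  define E where "E x v = (R\<^sup>2 - x \<bullet> x) *\<^sub>R D x v - 2 *\<^sub>R ((x \<bullet> v) *\<^sub>R X x)" for x v
  have trE: "lin_trace (E x) = - 2 * (x \<bullet> X x)" if "x \<in> U" for x
    using div[OF that] lin_trace_rank_one[of "x" "X x"] unfolding E_def
    by (simp add: lin_trace_diff lin_trace_scaleR del: scaleR_scaleR)
  have "integral (cball 0 R) (\<lambda>x. lin_trace (E x)) = 0"
  proof (rule integral_divergence_zero[OF U R])
    show "((\<lambda>x. (R\<^sup>2 - x \<bullet> x) *\<^sub>R X x) has_derivative E x) (at x)" if "x \<in> U" for x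
      unfolding E_def
      by (auto intro!: derivative_eq_intros der[OF that] simp: fun_eq_iff inner_commute algebra_simps)
    show "continuous_on U (\<lambda>x. E x b)" if "b \<in> Basis" for b
      unfolding E_def by (intro continuous_intros cont that contX)
    show "(R\<^sup>2 - x \<bullet> x) *\<^sub>R X x = 0" if "norm x = R" for x
      using that by (simp add: power2_norm_eq_inner[symmetric])
  qed
  moreover have "integral (cball 0 R) (\<lambda>x. lin_trace (E x)) = integral (cball 0 R) (\<lambda>x. (- 2) * (x \<bullet> X x))"
    using U trE by (intro integral_cong) auto
  ultimately show ?thesis by (simp only: integral_mult_right)
qed

section \<open>Green's identity for dilations and the mean value property\<close>

definition harmonic_data where
  "harmonic_data U u g D \<longleftrightarrow> open U \<and>
     (\<forall>x\<in>U. (u has_derivative (\<lambda>v. g x \<bullet> v)) (at x)) \<and>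
     (\<forall>x\<in>U. (g has_derivative D x) (at x)) \<and>
     (\<forall>b\<in>Basis. continuous_on U (\<lambda>x. D x b)) \<and>
     (\<forall>x\<in>U. lin_trace (D x) = 0)" for u :: "'a::euclidean_space \<Rightarrow> real" and g :: "'a \<Rightarrow> 'a"

lemma harmonic_data_continuous:
  assumes "harmonic_data U u g D"
  shows "continuous_on U u" "continuous_on U g"
  using assms unfolding harmonic_data_def
  by (meson continuous_at_imp_continuous_on has_derivative_continuous)+

lemma harmonic_dataD:
  assumes "harmonic_data U u g D"
  shows "open U" "\<And>x. x \<in> U \<Longrightarrow> (u has_derivative (\<lambda>v. g x \<bullet> v)) (at x)"
     "\<And>x. x \<in> U \<Longrightarrow> (g has_derivative D x) (at x)"
     "\<And>b. b \<in> Basis \<Longrightarrow> continuous_on U (\<lambda>x. D x b)"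
     "\<And>x. x \<in> U \<Longrightarrow> lin_trace (D x) = 0"
     "\<And>x. x \<in> U \<Longrightarrow> linear (D x)"
  using assms has_derivative_linear unfolding harmonic_data_def by blast+

lemma continuous_on_dilation:
  fixes f :: "'a::real_normed_vector \<Rightarrow> 'b::topological_space"
  assumes "continuous_on (ball 0 1) f" "S \<subseteq> {x. p *\<^sub>R x \<in> ball 0 1}"
  shows "continuous_on S (\<lambda>x. f (p *\<^sub>R x))"
  using assms by (intro continuous_on_compose2[OF assms(1)] continuous_intros) auto

text \<open>For the harmonic functions U(x) = u(p x) and W(x) = w(r x) the field W grad U - U grad W
  is divergence-free, and its radial part is the integrand. Taking w = 1 yields the mean value
  property, w = u the product formula for dilations.\<close>

lemma integral_dilations_Green:
  fixes u w :: "'a::euclidean_space \<Rightarrow> real"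
  assumes u: "harmonic_data (ball 0 1) u g D" and w: "harmonic_data (ball 0 1) w h E"
    and R: "R > 0" and p: "\<bar>p\<bar> * R < 1" and r: "\<bar>r\<bar> * R < 1"
  shows "integral (cball 0 R) (\<lambda>x. x \<bullet> ((p * w (r *\<^sub>R x)) *\<^sub>R g (p *\<^sub>R x) - (r * u (p *\<^sub>R x)) *\<^sub>R h (r *\<^sub>R x))) = 0"
proof -
  note U = harmonic_dataD[OF u] and W = harmonic_dataD[OF w]
  note cu = harmonic_data_continuous[OF u] and cw = harmonic_data_continuous[OF w]
  \<comment> \<open>The set where both dilates are defined; the bounds on \<open>p\<close> and
    \<open>r\<close> place the ball of radius \<open>R\<close> inside it.\<close>
  define V where "V = {x::'a. p *\<^sub>R x \<in> ball 0 1} \<inter> {x. r *\<^sub>R x \<in> ball 0 1}"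
  have Vp: "V \<subseteq> {x. p *\<^sub>R x \<in> ball 0 1}" and Vr: "V \<subseteq> {x. r *\<^sub>R x \<in> ball 0 1}" by (auto simp: V_def)
  \<comment> \<open>Product rule for the field. In its trace the two terms with the inner product of
    \<open>g\<close> and \<open>h\<close> cancel, and the others contain the traces of
    \<open>D\<close> and \<open>E\<close>, which are zero.\<close>
  define F where "F x v = p *\<^sub>R (w (r *\<^sub>R x) *\<^sub>R (p *\<^sub>R D (p *\<^sub>R x) v) + r *\<^sub>R ((h (r *\<^sub>R x) \<bullet> v) *\<^sub>R g (p *\<^sub>R x)))
      - r *\<^sub>R (u (p *\<^sub>R x) *\<^sub>R (r *\<^sub>R E (r *\<^sub>R x) v) + p *\<^sub>R ((g (p *\<^sub>R x) \<bullet> v) *\<^sub>R h (r *\<^sub>R x)))" for x v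
  show ?thesis
  proof (rule integral_radial_part_zero[where U = V and D = F])
    show "open V" unfolding V_def
      by (intro open_Int open_Collect_conj) (auto simp: dist_norm intro!: open_Collect_less continuous_intros)
    show "cball 0 R \<subseteq> V"
    proof
      fix x :: 'a assume "x \<in> cball 0 R"
      then have "\<bar>p\<bar> * norm x \<le> \<bar>p\<bar> * R" "\<bar>r\<bar> * norm x \<le> \<bar>r\<bar> * R" by (auto intro!: mult_left_mono)
      then show "x \<in> V" using p r by (auto simp: V_def)
    qed
    fix x assume "x \<in> V"
    then have x: "p *\<^sub>R x \<in> ball 0 1" "r *\<^sub>R x \<in> ball 0 1" unfolding V_def by auto
    have [derivative_intros]:
      "((\<lambda>x. g (p *\<^sub>R x)) has_derivative (\<lambda>v. D (p *\<^sub>R x) (p *\<^sub>R v))) (at x)"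
      "((\<lambda>x. h (r *\<^sub>R x)) has_derivative (\<lambda>v. E (r *\<^sub>R x) (r *\<^sub>R v))) (at x)"
      "((\<lambda>x. u (p *\<^sub>R x)) has_derivative (\<lambda>v. g (p *\<^sub>R x) \<bullet> (p *\<^sub>R v))) (at x)"
      "((\<lambda>x. w (r *\<^sub>R x)) has_derivative (\<lambda>v. h (r *\<^sub>R x) \<bullet> (r *\<^sub>R v))) (at x)"
      by (rule has_derivative_compose[OF _ U(3)] has_derivative_compose[OF _ W(3)]
          has_derivative_compose[OF _ U(2)] has_derivative_compose[OF _ W(2)];
          use x in \<open>auto intro!: derivative_eq_intros\<close>)+
    show "((\<lambda>x. (p * w (r *\<^sub>R x)) *\<^sub>R g (p *\<^sub>R x) - (r * u (p *\<^sub>R x)) *\<^sub>R h (r *\<^sub>R x)) has_derivative F x) (at x)"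
      unfolding F_def
      by (rule has_derivative_eq_rhs, (rule derivative_intros)+)
         (auto simp: fun_eq_iff linear_scale[OF U(6)[OF x(1)]] linear_scale[OF W(6)[OF x(2)]] algebra_simps)
    show "lin_trace (F x) = 0"
      using U(5)[OF x(1)] W(5)[OF x(2)] unfolding F_def
      by (simp add: lin_trace_diff lin_trace_add lin_trace_scaleR lin_trace_rank_one del: scaleR_scaleR)
        (simp add: inner_commute)
  next
    fix b :: 'a assume b: "b \<in> Basis"
    show "continuous_on V (\<lambda>x. F x b)"
      unfolding F_def
      by (intro continuous_intros continuous_on_dilation[OF _ Vp] continuous_on_dilation[OF _ Vr] cu cw 
          continuous_on_dilation[OF U(4)[OF b] Vp] continuous_on_dilation[OF W(4)[OF b] Vr])
  qed (use R in auto)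
qed

text \<open>On a compact interval around \<open>t0\<close> times \<open>K\<close> the continuous
  \<open>\<phi>'\<close> is bounded, and the mean value inequality turns this bound into a Lipschitz
  constant.\<close>

lemma has_real_derivative_integral_compact:
  fixes \<phi> :: "real \<Rightarrow> 'a::euclidean_space \<Rightarrow> real"
  assumes T: "open T" "t0 \<in> T" and K: "compact K"
    and der: "\<And>t x. t \<in> T \<Longrightarrow> x \<in> K \<Longrightarrow> ((\<lambda>t. \<phi> t x) has_real_derivative \<phi>' t x) (at t)"
    and cont: "continuous_on (T \<times> K) (\<lambda>(t, x). \<phi>' t x)"
    and cont0: "\<And>t. t \<in> T \<Longrightarrow> continuous_on K (\<phi> t)"
  shows "((\<lambda>t. integral K (\<phi> t)) has_real_derivative integral K (\<phi>' t0)) (at t0)"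
proof -
  obtain d where d: "d > 0" "cball t0 d \<subseteq> T" using T open_contains_cball by blast
  have "bounded ((\<lambda>(t, x). \<phi>' t x) ` (cball t0 d \<times> K))"
    using d K by (intro compact_imp_bounded compact_continuous_image continuous_on_subset[OF cont] compact_Times) auto
  then obtain C where C: "\<And>t x. t \<in> cball t0 d \<Longrightarrow> x \<in> K \<Longrightarrow> \<bar>\<phi>' t x\<bar> \<le> C"
    unfolding bounded_iff by force
  show ?thesis
  proof (rule has_real_derivative_integral[where d=d and C="\<lambda>_. C" and N="{}"])
    show "(\<lambda>_. C) integrable_on K" using K by (intro integrable_on_const lmeasurable_compact)
    show "\<phi> t integrable_on K" if "\<bar>t - t0\<bar> < d" for t
      using absolutely_integrable_continuous_compact[OF K cont0, of t] that d
      by (auto simp: absolutely_integrable_on_def dist_real_def subset_iff)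
    show "\<bar>\<phi> t x - \<phi> t0 x\<bar> \<le> C * \<bar>t - t0\<bar>" if "\<bar>t - t0\<bar> < d" "x \<in> K" for t x
    proof -
      have "norm (\<phi> t x - \<phi> t0 x) \<le> C * norm (t - t0)"
        using d that C by (intro field_differentiable_bound[where S="cball t0 d" and f'="\<lambda>t. \<phi>' t x"])
           (auto intro!: has_field_derivative_at_within[OF der] simp: dist_real_def)
      then show ?thesis by simp
    qed
  qed (use d der T in auto)
qed

lemma harmonic_dilation_derivative:
  assumes "harmonic_data (ball 0 1) u g D" "c t *\<^sub>R x \<in> ball 0 1" "(c has_real_derivative c') (at t)"
  shows "((\<lambda>t. u (c t *\<^sub>R x)) has_real_derivative c' * (g (c t *\<^sub>R x) \<bullet> x)) (at t)"
proof -
  have "((\<lambda>t. u (c t *\<^sub>R x)) has_derivative (\<lambda>v. g (c t *\<^sub>R x) \<bullet> ((c' * v) *\<^sub>R x))) (at t)"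
    using assms(3) unfolding has_field_derivative_def
    by (intro has_derivative_compose[of "\<lambda>t. c t *\<^sub>R x" "\<lambda>v. (c' * v) *\<^sub>R x" t UNIV u
            "\<lambda>v. g (c t *\<^sub>R x) \<bullet> v"] harmonic_dataD(2)[OF assms(1,2)])
       (auto intro!: derivative_eq_intros simp: mult.commute)
  then show ?thesis unfolding has_field_derivative_def
    by (rule has_derivative_eq_rhs) (simp add: fun_eq_iff)
qed

lemma harmonic_data_const: "harmonic_data (ball 0 1) (\<lambda>_. c) (\<lambda>_. 0) (\<lambda>_ _. 0)"
  by (auto simp: harmonic_data_def lin_trace_def)

text \<open>The integral of u(t x) over the ball is constant for t in [0, 1], since its derivative
  is killed by Green's identity against the constant 1. The values at t = 1 and t = 0 are the two
  sides.\<close>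

lemma mean_value_cball:
  fixes u :: "'a::euclidean_space \<Rightarrow> real"
  assumes u: "harmonic_data (ball 0 1) u g D" and R: "0 < R" "R < 1"
  shows "integral (cball 0 R) u = u 0 * measure lebesgue (cball (0::'a) R)"
proof -
  \<comment> \<open>The scales that keep the ball of radius \<open>R\<close> inside the unit ball;
    \<open>R < 1\<close> puts all of [0, 1] in \<open>T\<close>.\<close>
  define T where "T = {- 1 / R <..< 1 / R}"
  have T: "t *\<^sub>R x \<in> ball 0 1" if "t \<in> T" "x \<in> cball 0 R" for t and x :: 'a
  proof -
    have "\<bar>t\<bar> * R < 1" using that R by (auto simp: T_def field_simps abs_less_iff)
    moreover have "\<bar>t\<bar> * norm x \<le> \<bar>t\<bar> * R" using that by (auto intro: mult_left_mono)
    ultimately show ?thesis by simp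
  qed
  define \<phi> where "\<phi> t = integral (cball 0 R) (\<lambda>x. u (t *\<^sub>R x))" for t
  have der: "(\<phi> has_real_derivative integral (cball 0 R) (\<lambda>x. 1 * (g (t *\<^sub>R x) \<bullet> x))) (at t)" if "t \<in> T" for t
    unfolding \<phi>_def
  proof (rule has_real_derivative_integral_compact[where T=T])
    show "((\<lambda>t. u (t *\<^sub>R x)) has_real_derivative 1 * (g (t *\<^sub>R x) \<bullet> x)) (at t)" if "t \<in> T" "x \<in> cball 0 R" for t x
      using harmonic_dilation_derivative[OF u, of "\<lambda>t. t" t x 1] T[OF that] by auto
    show "continuous_on (T \<times> cball 0 R) (\<lambda>(t, x). 1 * (g (t *\<^sub>R x) \<bullet> x))"
      unfolding case_prod_unfold using T
      by (intro continuous_intros continuous_on_compose2[OF harmonic_data_continuous(2)[OF u]]) auto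
    show "continuous_on (cball 0 R) (\<lambda>x. u (t *\<^sub>R x))" if "t \<in> T" for t
      using T[OF that] by (intro continuous_on_dilation[OF harmonic_data_continuous(1)[OF u]]) auto
  qed (use that in \<open>auto simp: T_def\<close>)
  have "\<phi> 1 = \<phi> 0"
  proof (rule DERIV_isconst_end[of 0 1 \<phi>])
    have "- 1 / R < 0" "1 < 1 / R" using R by auto
    then have *: "{0..1} \<subseteq> T" unfolding T_def using less_trans by (auto intro: less_le_trans le_less_trans simp del: divide_minus_left)
    then show "continuous_on {0..1} \<phi>"
      using der by (meson DERIV_isCont continuous_at_imp_continuous_on subsetD)
    fix t :: real assume t: "0 < t" "t < 1"
    have "t * R < 1" using t R mult_strict_mono[of t 1 R 1] by simp
    \<comment> \<open>Green's identity with \<open>p = t\<close> and \<open>r = 0\<close>: only the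
      gradient of \<open>u\<close> survives, with a factor \<open>t\<close> to be divided
      out.\<close>
    then have "integral (cball 0 R) (\<lambda>x. t * (g (t *\<^sub>R x) \<bullet> x)) = 0"
      using integral_dilations_Green[OF u harmonic_data_const[of 1] R(1), of t 0] t
      by (simp add: inner_commute)
    then have "integral (cball 0 R) (\<lambda>x. 1 * (g (t *\<^sub>R x) \<bullet> x)) = 0" using t by simp
    moreover have "t \<in> T" using t * by auto
    ultimately show "DERIV \<phi> t :> 0" using der[of t] by simp
  qed simp
  moreover have "integral (cball (0::'a) R) (\<lambda>_. u 0 * 1) = u 0 * measure lebesgue (cball (0::'a) R)"
    by (simp only: integral_mult_right lmeasure_integral[OF lmeasurable_cball])
  ultimately show ?thesis by (simp add: \<phi>_def)
qed

section \<open>Uniqueness: zero boundary values and unique continuation\<close>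

lemma integral_zero_imp_zero_on_open:
  fixes f :: "'a::euclidean_space \<Rightarrow> real"
  assumes "open U" "U \<subseteq> S" "continuous_on U f" "f integrable_on S" "integral S f = 0"
    and nonneg: "\<And>x. x \<in> S \<Longrightarrow> f x \<ge> 0" and x: "x \<in> U"
  shows "f x = 0"
proof -
  obtain a b where ab: "x \<in> box a b" "cbox a b \<subseteq> U"
    using open_contains_cbox assms(1) x by metis
  have sub: "cbox a b \<subseteq> S" using ab assms by blast
  have cont: "continuous_on (cbox a b) f" using ab assms continuous_on_subset by blast
  then have int: "f integrable_on cbox a b" by (rule integrable_continuous)
  have "integral (cbox a b) f \<le> integral S f"
    using assms sub int by (intro integral_subset_le) auto
  moreover have "integral (cbox a b) f \<ge> 0" using nonneg sub int by (intro integral_nonneg) auto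
  ultimately have "(f has_integral 0) (cbox a b)" using int assms by (simp add: has_integral_iff)
  then show ?thesis
    using cont nonneg sub ab box_subset_cbox by (intro has_integral_0_cbox_imp_0[of a b f x]) blast+
qed

text \<open>Dirichlet principle: u grad u vanishes on the sphere and has divergence |grad u|^2, so
  the gradient is zero in the ball and \<open>u\<close> is constant there; the constant is read off
  on the sphere.\<close>

lemma harmonic_zero_on_sphere_imp_zero:
  fixes u :: "'a::euclidean_space \<Rightarrow> real"
  assumes u: "harmonic_data (ball 0 1) u g D" and R: "0 < R" "R < 1"
    and zero: "\<And>x. norm x = R \<Longrightarrow> u x = 0" and x: "norm x < R"
  shows "u x = 0"
proof -
  note U = harmonic_dataD[OF u] and cu = harmonic_data_continuous[OF u]
  have sub: "cball 0 R \<subseteq> ball (0::'a) 1" using R by auto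
  have "integral (cball 0 R) (\<lambda>x. lin_trace (\<lambda>v. u x *\<^sub>R D x v + (g x \<bullet> v) *\<^sub>R g x)) = 0"
    using zero R sub
    by (intro integral_divergence_zero[where U="ball 0 1" and X="\<lambda>x. u x *\<^sub>R g x"])
       (auto intro!: derivative_eq_intros U(2,3) continuous_intros cu U(4) simp: U(2,3))
  moreover have "integral (cball 0 R) (\<lambda>x. lin_trace (\<lambda>v. u x *\<^sub>R D x v + (g x \<bullet> v) *\<^sub>R g x)) = integral (cball 0 R) (\<lambda>x. g x \<bullet> g x)"
    using sub by (intro integral_cong) (auto simp: lin_trace_add lin_trace_scaleR lin_trace_rank_one U(5) subset_iff)
  ultimately have *: "integral (cball 0 R) (\<lambda>x. g x \<bullet> g x) = 0" by simp
  have cg: "continuous_on (cball 0 R) (\<lambda>x. g x \<bullet> g x)"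
    using sub cu(2) by (auto intro!: continuous_intros elim: continuous_on_subset)
  have g0: "g x = 0" if "x \<in> ball 0 R" for x
    using integral_zero_imp_zero_on_open[of "ball 0 R" "cball 0 R" "\<lambda>x. g x \<bullet> g x" x] * that
      continuous_on_subset[OF cg ball_subset_cball]
      absolutely_integrable_continuous_compact[OF compact_cball cg]
    by (auto simp: absolutely_integrable_on_def)
  have "(u has_derivative (\<lambda>v. 0)) (at x within ball 0 R)" if "x \<in> ball 0 R" for x
    using has_derivative_at_withinI[OF U(2)[of x]] sub that g0[OF that] ball_subset_cball by (auto simp: subset_iff)
  then obtain c where c: "\<And>x. x \<in> ball 0 R \<Longrightarrow> u x = c"
    using has_derivative_zero_constant[of "ball 0 R" u] convex_ball by blast
  have clo: "closure (ball 0 R) = cball (0::'a) R" using R by simp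
  have "continuous_on (closure (ball 0 R)) u"
    unfolding clo by (rule continuous_on_subset[OF cu(1) sub])
  from continuous_constant_on_closure[OF this c] have "u z = c" if "norm z \<le> R" for z
    using that unfolding clo by simp
  moreover obtain b :: 'a where "b \<in> Basis" using nonempty_Basis by blast
  then have "norm (R *\<^sub>R b) = R" using R by simp
  ultimately have "c = 0" using zero[of "R *\<^sub>R b"] by fastforce
  then show ?thesis using c x by simp
qed

text \<open>With q = sqrt (a s) the two scales are q t and q / t for t = s / q, and t = 1 gives the
  square. The integral with these scales is constant in t, because its derivative is Green's
  identity for \<open>u\<close> against itself, up to the factor t.\<close>

lemma harmonic_dilations_product:
  fixes u :: "'a::euclidean_space \<Rightarrow> real"
  assumes u: "harmonic_data (ball 0 1) u g D" and a: "0 < a" "a \<le> s" "s < 1"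
  shows "integral (cball 0 1) (\<lambda>x. u (s *\<^sub>R x) * u (a *\<^sub>R x)) =
         integral (cball 0 1) (\<lambda>x. (u (sqrt (a * s) *\<^sub>R x))\<^sup>2)"
proof -
  define q where "q = sqrt (a * s)"
  have q: "0 < q" "q * q = a * s" "q < 1" "q \<le> s"
  proof -
    have "a * s \<le> s * s" using a by (simp add: mult_right_mono)
    then show "q \<le> s" unfolding q_def using a by (intro real_le_lsqrt) (auto simp: power2_eq_square)
    then show "q < 1" using a by simp
  qed (use a in \<open>auto simp: q_def\<close>)
  \<comment> \<open>Exactly the positive \<open>t\<close> for which both scales \<open>q * t\<close>
    and \<open>q / t\<close> are below 1.\<close>
  define T where "T = {q <..< 1 / q}"
  have T: "(q * t) *\<^sub>R x \<in> ball 0 1" "(q / t) *\<^sub>R x \<in> ball 0 1" "t > 0" "q * t < 1" "q / t < 1"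
    if "t \<in> T" "x \<in> cball 0 1" for t and x :: 'a
  proof -
    show t: "t > 0" "q * t < 1" "q / t < 1" using that q by (auto simp: T_def field_simps)
    have "(q * t) * norm x \<le> q * t" "(q / t) * norm x \<le> q / t"
      using t q that by (intro mult_left_le; simp)+
    then have "(q * t) * norm x < 1" "(q / t) * norm x < 1" using t by linarith+
    then show "(q * t) *\<^sub>R x \<in> ball 0 1" "(q / t) *\<^sub>R x \<in> ball 0 1" using t q by (auto simp: abs_mult)
  qed
  define \<phi> where "\<phi> t = integral (cball 0 1) (\<lambda>x. u ((q * t) *\<^sub>R x) * u ((q / t) *\<^sub>R x))" for t
  define \<phi>' where "\<phi>' t x = q * (g ((q * t) *\<^sub>R x) \<bullet> x) * u ((q / t) *\<^sub>R x) +
      - q / t\<^sup>2 * (g ((q / t) *\<^sub>R x) \<bullet> x) * u ((q * t) *\<^sub>R x)" for t x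
  have der: "(\<phi> has_real_derivative integral (cball 0 1) (\<phi>' t)) (at t)" if "t \<in> T" for t
    unfolding \<phi>_def
  proof (rule has_real_derivative_integral_compact[where T=T])
    show "((\<lambda>t. u ((q * t) *\<^sub>R x) * u ((q / t) *\<^sub>R x)) has_real_derivative \<phi>' t x) (at t)"
      if "t \<in> T" "x \<in> cball 0 1" for t x
      unfolding \<phi>'_def using T[OF that]
      by (intro DERIV_mult harmonic_dilation_derivative[OF u])
         (auto intro!: derivative_eq_intros simp: power2_eq_square)
    show "continuous_on (T \<times> cball 0 1) (\<lambda>(t, x). \<phi>' t x)"
      unfolding case_prod_unfold \<phi>'_def using T
      by (intro continuous_intros continuous_on_compose2[OF harmonic_data_continuous(2)[OF u]]
          continuous_on_compose2[OF harmonic_data_continuous(1)[OF u]]) (auto, fastforce+)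
    show "continuous_on (cball 0 1) (\<lambda>x. u ((q * t) *\<^sub>R x) * u ((q / t) *\<^sub>R x))" if "t \<in> T" for t
      using T[OF that] by (intro continuous_intros continuous_on_dilation[OF harmonic_data_continuous(1)[OF u]]) auto
  qed (use that in \<open>auto simp: T_def\<close>)
  have der0: "DERIV \<phi> t :> 0" if "t \<in> T" for t
  proof -
    have t: "t > 0" "q * t < 1" "q / t < 1" using T[OF that, of 0] by auto
    \<comment> \<open>The factor \<open>t\<close> turns the coefficients q and q / t^2 of
      \<open>\<phi>'\<close> into the scales q t and q / t, as Green's identity has them.\<close>
    have "integral (cball 0 1) (\<lambda>x. t * \<phi>' t x) = 0"
      using integral_dilations_Green[OF u u, of 1 "q * t" "q / t"] t q
      by (simp add: \<phi>'_def inner_diff_right inner_commute algebra_simps power2_eq_square)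
    then show ?thesis using der[OF that] t by simp
  qed
  have "\<phi> (s / q) = \<phi> 1"
  proof (cases "s / q = 1")
    case False
    have 1: "1 < s / q" using q False by (auto simp: field_simps)
    have sub: "{1..s/q} \<subseteq> T" using q divide_strict_right_mono[OF a(3) q(1)] unfolding T_def by auto
    show ?thesis
    proof (rule DERIV_isconst_end[OF 1])
      show "continuous_on {1..s/q} \<phi>" 
        using der0 sub by (meson DERIV_isCont continuous_at_imp_continuous_on subsetD)
      show "DERIV \<phi> x :> 0" if "1 < x" "x < s / q" for x
        using der0 sub that by (simp add: subset_iff)
    qed
  qed simp
  moreover have "q / (s / q) = a" using q a by (simp add: field_simps)
  ultimately show ?thesis using q by (simp add: \<phi>_def q_def[symmetric] power2_eq_square)
qed

text \<open>Let s be the supremum of the radii up to 1 on which \<open>u\<close> vanishes. If s < 1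
  and c < s, suitable scales t and c / t with c / t < s make the product integral zero, hence also
  the integral of u(sqrt c x)^2. So \<open>u\<close> vanishes up to radius sqrt s > s, a
  contradiction.\<close>

lemma harmonic_zero_near_0_imp_zero:
  fixes u :: "'a::euclidean_space \<Rightarrow> real"
  assumes u: "harmonic_data (ball 0 1) u g D" and a: "0 < a" "a < 1"
    and zero: "\<And>x. norm x < a \<Longrightarrow> u x = 0" and x: "norm x < 1"
  shows "u x = 0"
proof -
  define Z where "Z = {b. 0 < b \<and> b \<le> 1 \<and> (\<forall>x. norm x < b \<longrightarrow> u x = 0)}"
  have Z: "a \<in> Z" "bdd_above Z" using a zero by (auto simp: Z_def bdd_above_def)
  define s where "s = Sup Z"
  have "a \<le> s" unfolding s_def using Z by (rule cSup_upper)
  moreover have "s \<le> 1" unfolding s_def using Z(1) by (intro cSup_least) (auto simp: Z_def)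
  ultimately have s: "0 < s" "s \<le> 1" using a by auto
  have us: "u x = 0" if "norm x < s" for x
    using that less_cSup_iff[of Z "norm x"] Z by (auto simp: s_def Z_def)
  have "s = 1"
  proof (rule ccontr)
    assume "s \<noteq> 1"
    then have s1: "s < 1" using s by simp
    have "u x = 0" if x: "norm x < sqrt s" for x
    proof -
      have "norm x * norm x < s"
        using mult_strict_mono'[OF x x] s by simp
      then obtain c where c: "norm x * norm x < c" "c < s" using dense by blast
      then have c0: "0 < c" by (meson le_less_trans mult_nonneg_nonneg norm_ge_zero)
      \<comment> \<open>\<open>c / s < t\<close> gives \<open>c / t < s\<close>, where
        \<open>u\<close> is known to vanish; together with \<open>s < t\<close> it gives
        \<open>c / t \<le> t\<close>, the order of scales in
        \<open>harmonic_dilations_product\<close>.\<close>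
      obtain t where t: "c / s < t" "s < t" "t < 1"
        using dense[of "max (c / s) s" 1] c s1 s by auto
      have a': "0 < c / t" "c / t < s" "c / t \<le> t" "c / t * t = c"
      using t c c0 s mult_strict_mono[of s t s t] by (auto simp: field_simps intro: order_trans[OF less_imp_le])
      have "sqrt c < 1" using c s1 by simp
      have cont: "continuous_on (cball 0 1) (\<lambda>x. (u (sqrt c *\<^sub>R x))\<^sup>2)"
        using c0 \<open>sqrt c < 1\<close> 
        by (intro continuous_intros continuous_on_dilation[OF harmonic_data_continuous(1)[OF u]])
          (auto intro: le_less_trans[OF mult_left_le])
      have int0: "integral (cball 0 1) (\<lambda>x. (u (sqrt c *\<^sub>R x))\<^sup>2) = 0"
      proof -
        have "u ((c / t) *\<^sub>R x) = 0" if "x \<in> cball 0 1" for x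
        proof (rule us)
          have "norm ((c / t) *\<^sub>R x) = c / t * norm x" using a'(1) abs_of_pos[OF a'(1)] by (simp only: norm_scaleR real_norm_def)
          also have "\<dots> \<le> c / t" using that a'(1) by (intro mult_left_le) auto
          finally show "norm ((c / t) *\<^sub>R x) < s" using a'(2) by linarith
        qed
        then have "integral (cball 0 1) (\<lambda>x. u (t *\<^sub>R x) * u ((c / t) *\<^sub>R x)) = integral (cball 0 1) (\<lambda>x::'a. 0)"
          by (intro integral_cong) auto
        then show ?thesis using harmonic_dilations_product[OF u a'(1,3) t(3)] a'(4) by simp
      qed
      have "norm x < sqrt c" using c by (simp add: real_less_rsqrt power2_eq_square)
      then have "(u (sqrt c *\<^sub>R (x /\<^sub>R sqrt c)))\<^sup>2 = 0"
        using c0 int0 by (intro integral_zero_imp_zero_on_open[of "ball 0 1" "cball 0 1" "\<lambda>x. (u (sqrt c *\<^sub>R x))\<^sup>2"]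
            continuous_on_subset[OF cont] set_lebesgue_integral_eq_integral(1)
            absolutely_integrable_continuous_compact cont) (auto simp: field_simps)
      then show ?thesis using c0 by simp
    qed
    then have "sqrt s \<in> Z" using s by (simp add: Z_def)
    then have "sqrt s \<le> s" unfolding s_def using Z by (simp add: cSup_upper)
    then have "s \<le> s * s" using s by (simp add: real_sqrt_le_iff' power2_eq_square)
    then show False using s s1 by simp
  qed
  then show ?thesis using us x by simp
qed

section \<open>From \<open>harmonic_on\<close> to \<open>harmonic_data\<close>, and the mean value
  over the open unit ball\<close>

lemma Basis_real_vec: "(Basis :: (real^'n) set) = range (\<lambda>i. axis i 1)"
  by (auto simp: Basis_vec_def)

lemma lin_trace_matrix: "lin_trace ((*v) A) = trace (A :: real^'n^'n)"
proof -
  have "lin_trace ((*v) A) = (\<Sum>i\<in>UNIV. (A *v axis i 1) \<bullet> axis i 1)"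
    unfolding lin_trace_def Basis_real_vec
    by (subst sum.reindex) (auto intro: injI simp: axis_eq_axis)
  then show ?thesis by (simp add: trace_def inner_axis matrix_vector_mul_component cart_eq_inner_axis[symmetric] row_def)
qed

text \<open>\<open>harmonic_data\<close> names the gradient and replaces the Hessian matrix by its
  linear map, which lets the arguments above run in any Euclidean space. The way back is
  \<open>harmonic_data_imp_harmonic_on\<close>.\<close>

lemma harmonic_on_imp_data:
  fixes u :: "real^'n \<Rightarrow> real"
  assumes "harmonic_on S u"
  obtains g D where "harmonic_data S u g D"
proof -
  obtain g :: "real^'n \<Rightarrow> real^'n" and H :: "real^'n \<Rightarrow> real^'n^'n" where
    gH: "open S" "\<forall>x\<in>S. (u has_derivative (\<lambda>v. g x \<bullet> v)) (at x)"
        "\<forall>x\<in>S. (g has_derivative (\<lambda>v. H x *v v)) (at x)"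
        "continuous_on S H" "\<forall>x\<in>S. trace (H x) = 0"
    using assms unfolding harmonic_on_def by blast
  have "continuous_on S (\<lambda>x. H x *v b)" for b
    unfolding matrix_vector_mult_def
    by (intro continuous_on_vec_lambda continuous_intros gH(4))
  then have "harmonic_data S u g (\<lambda>x. (*v) (H x))"
    using gH unfolding harmonic_data_def by (auto simp: lin_trace_matrix)
  then show ?thesis by (rule that)
qed

lemma harmonic_data_diff:
  assumes "harmonic_data S u g D" "harmonic_data S w h E"
  shows "harmonic_data S (\<lambda>x. u x - w x) (\<lambda>x. g x - h x) (\<lambda>x v. D x v - E x v)"
  unfolding harmonic_data_def inner_diff_left
  using harmonic_dataD[OF assms(1)] harmonic_dataD[OF assms(2)]
  by (auto simp: lin_trace_diff intro!: has_derivative_diff continuous_on_diff)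

text \<open>An integrable harmonic function may be unbounded near the unit sphere, so the formula
  for closed balls is taken to the limit of radii tending to 1, dominated by \<bar>u\<bar>.\<close>

lemma mean_value_ball:
  fixes u :: "'a::euclidean_space \<Rightarrow> real"
  assumes u: "harmonic_data (ball 0 1) u g D" and int: "u absolutely_integrable_on ball 0 1"
  shows "integral (ball 0 1) u = u 0 * unit_ball_vol (real DIM('a))"
proof -
  define R where "R k = 1 - 1 / real (k + 2)" for k
  have R: "0 < R k" "R k < 1" for k by (auto simp: R_def)
  have Rlim: "R \<longlonglongrightarrow> 1"
    unfolding R_def by real_asymp
  define f where "f k x = (if x \<in> cball 0 (R k) then u x else 0)" for k x
  have uint: "u absolutely_integrable_on cball 0 (R k)" for k
    using R[of k] by (intro set_integrable_subset[OF int]) auto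
  have f: "(f k has_integral integral (cball 0 (R k)) u) (ball 0 1)" for k
    unfolding f_def using R[of k] set_lebesgue_integral_eq_integral(1)[OF uint]
    by (subst has_integral_restrict) (auto simp: has_integral_integral[symmetric])
  have "(\<lambda>k. integral (ball 0 1) (f k)) \<longlonglongrightarrow> integral (ball 0 1) u"
  proof (rule dominated_convergence)
    show "f k integrable_on ball 0 1" for k using f by blast
    show "(\<lambda>x. norm (u x)) integrable_on ball 0 1" using int by (simp add: absolutely_integrable_on_def)
    show "(\<lambda>k. f k x) \<longlonglongrightarrow> u x" if "x \<in> ball 0 1" for x
    proof (rule tendsto_eventually)
      have "\<forall>\<^sub>F k in sequentially. norm x < R k"
        using that by (intro order_tendstoD[OF Rlim]) auto
      then show "\<forall>\<^sub>F k in sequentially. f k x = u x"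
        by eventually_elim (simp add: f_def)
    qed
  qed (auto simp: f_def)
  moreover have "integral (ball 0 1) (f k) = u 0 * (unit_ball_vol (real DIM('a)) * R k ^ DIM('a))" for k
    using integral_unique[OF f] mean_value_cball[OF u R] R[of k] content_cball[of "R k" "0::'a"]
    by simp
  moreover have "(\<lambda>k. u 0 * (unit_ball_vol (real DIM('a)) * R k ^ DIM('a))) \<longlonglongrightarrow> 
      u 0 * (unit_ball_vol (real DIM('a)) * 1 ^ DIM('a))"
    by (intro tendsto_intros Rlim)
  ultimately show ?thesis using LIMSEQ_unique by fastforce
qed

section \<open>The sign function and the optimality criterion\<close>

definition shell_sign :: "real \<Rightarrow> 'a::real_normed_vector \<Rightarrow> real" where
  "shell_sign r x = (if norm x \<le> r then 1 else - 1)"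

lemma shell_sign_integral:
  fixes f :: "'a::euclidean_space \<Rightarrow> real"
  assumes f: "f absolutely_integrable_on ball 0 1" and r: "r < 1"
  shows "(\<lambda>x. shell_sign r x * f x) absolutely_integrable_on ball 0 1"
    "integral (ball 0 1) (\<lambda>x. shell_sign r x * f x) = 2 * integral (cball 0 r) f - integral (ball 0 1) f"
proof -
  define F where "F x = (if x \<in> cball 0 r then f x else 0)" for x
  have sub: "cball 0 r \<subseteq> ball (0::'a) 1" using r by auto
  have "f absolutely_integrable_on cball 0 r"
    using sub by (intro set_integrable_subset[OF f]) auto
  then have "F absolutely_integrable_on UNIV"
    unfolding F_def by (subst absolutely_integrable_restrict_UNIV)
  then have F: "F absolutely_integrable_on ball 0 1" by (rule set_integrable_subset) auto
  have IF: "integral (ball 0 1) F = integral (cball 0 r) f"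
    unfolding F_def integral_restrict_Int using sub by (simp only: Int_absorb2)
  \<comment> \<open>The sign function is twice the indicator of the inner ball minus 1.\<close>
  have eq: "shell_sign r x * f x = 2 * F x - f x" for x by (simp add: shell_sign_def F_def)
  have 2: "(\<lambda>x. 2 * F x) absolutely_integrable_on ball 0 1" using F by (rule set_integrable_mult_right)
  show "(\<lambda>x. shell_sign r x * f x) absolutely_integrable_on ball 0 1"
    unfolding eq using 2 f by (rule set_integral_diff(1))
  have "integral (ball 0 1) (\<lambda>x. 2 * F x - f x) = integral (ball 0 1) (\<lambda>x. 2 * F x) - integral (ball 0 1) f"
    using 2 f by (intro integral_diff set_lebesgue_integral_eq_integral(1))
  then show "integral (ball 0 1) (\<lambda>x. shell_sign r x * f x) = 2 * integral (cball 0 r) f - integral (ball 0 1) f"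
    unfolding eq by (simp add: IF)
qed

text \<open>By the mean value property the integral is \<open>u 0\<close> times twice the volume of
  the inner ball minus the volume of the unit ball, and the condition on \<open>r\<close> makes
  these equal.\<close>

lemma shell_sign_orthogonal:
  fixes u :: "'a::euclidean_space \<Rightarrow> real"
  assumes u: "harmonic_data (ball 0 1) u g D" and int: "u absolutely_integrable_on ball 0 1"
    and r: "0 < r" "r < 1" "r ^ DIM('a) = 1 / 2"
  shows "integral (ball 0 1) (\<lambda>x. shell_sign r x * u x) = 0"
  using shell_sign_integral(2)[OF int r(2)] mean_value_ball[OF u int] mean_value_cball[OF u r(1,2)] r
    content_cball[of r "0::'a"]
  by simp

lemma L1_norm_eq_integral:
  assumes "f absolutely_integrable_on unit_ball"
  shows "L1_norm f = integral unit_ball (\<lambda>x. \<bar>f x\<bar>)"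
  unfolding L1_norm_def
  by (rule set_lebesgue_integral_eq_integral(2)) (use absolutely_integrable_norm[OF assms] in \<open>simp add: o_def\<close>)

text \<open>The duality criterion, into which the kernels enter only through the sign pattern of f -
  h and the continuity of \<open>f\<close> off \<open>y\<close>. Both inequalities include the
  sphere of radius \<open>r\<close>, which forces f = h there and serves the uniqueness
  part.\<close>

lemma the_best_harmonic_approximantI:
  fixes f h :: "real^'n \<Rightarrow> real"
  assumes f: "f absolutely_integrable_on unit_ball" and h: "h \<in> L1_harmonic"
    and r: "0 < r" "r < 1" "r ^ CARD('n) = 1 / 2"
    and y: "norm y < r" and cont: "continuous_on (unit_ball - {y}) f"
    and inner: "\<And>x. x \<noteq> y \<Longrightarrow> norm x \<le> r \<Longrightarrow> h x \<le> f x"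
    and outer: "\<And>x. r \<le> norm x \<Longrightarrow> norm x < 1 \<Longrightarrow> f x \<le> h x"
  shows "the_best_harmonic_approximant f h"
proof -
  let ?S = "shell_sign r :: real^'n \<Rightarrow> real"
  let ?I = "integral (unit_ball :: (real^'n) set)"
  have sub: "(\<lambda>x. F x - G x) absolutely_integrable_on unit_ball"
    if "F absolutely_integrable_on unit_ball" "G absolutely_integrable_on unit_ball" for F G :: "real^'n \<Rightarrow> real"
    using that by (rule set_integral_diff(1))
  have L: "g absolutely_integrable_on unit_ball" "\<exists>G D. harmonic_data unit_ball g G D" if "g \<in> L1_harmonic" for g :: "real^'n \<Rightarrow> real"
    using that harmonic_on_imp_data unfolding L1_harmonic_def by blast+
  \<comment> \<open>h - g is integrable and harmonic, so replacing \<open>h\<close> by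
    \<open>g\<close> does not change the pairing with the sign function.\<close>
  have orth: "?I (\<lambda>x. ?S x * (f x - g x)) = ?I (\<lambda>x. ?S x * (f x - h x))" if g: "g \<in> L1_harmonic" for g
  proof -
    obtain G D where "harmonic_data unit_ball g G D" using L(2)[OF g] by blast
    moreover obtain H E where "harmonic_data unit_ball h H E" using L(2)[OF h] by blast
    ultimately have "harmonic_data unit_ball (\<lambda>x. h x - g x) (\<lambda>x. H x - G x) (\<lambda>x v. E x v - D x v)"
      by (intro harmonic_data_diff)
    from shell_sign_orthogonal[OF this sub[OF L(1)[OF h] L(1)[OF g]] r(1,2)]
    have 0: "?I (\<lambda>x. ?S x * (h x - g x)) = 0" using r by simp
    have "?I (\<lambda>x. ?S x * (f x - h x) + ?S x * (h x - g x)) = ?I (\<lambda>x. ?S x * (f x - h x)) + ?I (\<lambda>x. ?S x * (h x - g x))"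
      by (intro integral_add set_lebesgue_integral_eq_integral(1) shell_sign_integral(1) sub f L h g r)
    moreover have "?S x * (f x - h x) + ?S x * (h x - g x) = ?S x * (f x - g x)" for x
      by (simp add: algebra_simps)
    ultimately show ?thesis by (simp only: 0 add_0_right)
  qed
  have fh: "L1_norm (\<lambda>x. f x - h x) = ?I (\<lambda>x. ?S x * (f x - h x))"
  proof -
    have "L1_norm (\<lambda>x. f x - h x) = ?I (\<lambda>x. \<bar>f x - h x\<bar>)"
      by (intro L1_norm_eq_integral sub f L h)
    also have "\<dots> = ?I (\<lambda>x. ?S x * (f x - h x))"
    \<comment> \<open>At \<open>y\<close>, the pole in the applications, \<open>f\<close> has a
      default value and \<open>inner\<close> says nothing; one point is negligible.\<close>
    proof (rule integral_spike[where S = "{y}"])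
      show "?S x * (f x - h x) = \<bar>f x - h x\<bar>" if "x \<in> unit_ball - {y}" for x
        using inner[of x] outer[of x] that by (auto simp: shell_sign_def)
    qed auto
    finally show ?thesis .
  qed
  have absint: "(\<lambda>x. \<bar>f x - g x\<bar>) integrable_on unit_ball" if "g \<in> L1_harmonic" for g
    using sub[OF f L(1)[OF that]] unfolding absolutely_integrable_on_def by simp
  have sgnint: "(\<lambda>x. ?S x * (f x - g x)) integrable_on unit_ball" if "g \<in> L1_harmonic" for g
    by (intro set_lebesgue_integral_eq_integral(1) shell_sign_integral(1) sub f L that r)
  have fg: "L1_norm (\<lambda>x. f x - g x) = ?I (\<lambda>x. \<bar>f x - g x\<bar>)" if "g \<in> L1_harmonic" for g
    by (intro L1_norm_eq_integral sub f L that)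
  have le: "?S x * (f x - g x) \<le> \<bar>f x - g x\<bar>" for x g by (auto simp: shell_sign_def)
  have best: "L1_norm (\<lambda>x. f x - h x) \<le> L1_norm (\<lambda>x. f x - g x)" if g: "g \<in> L1_harmonic" for g
    unfolding fh fg[OF g] orth[OF g, symmetric] by (intro integral_le sgnint absint g le)
  have "g x = h x" if g: "best_harmonic_approximant f g" and x: "x \<in> unit_ball" for g x
  proof -
    have gL: "g \<in> L1_harmonic" and "L1_norm (\<lambda>x. f x - g x) \<le> L1_norm (\<lambda>x. f x - h x)"
      using g h unfolding best_harmonic_approximant_def by blast+
    then have eq: "?I (\<lambda>x. \<bar>f x - g x\<bar>) = ?I (\<lambda>x. ?S x * (f x - g x))"
      using best[OF gL] unfolding fg[OF gL] fh orth[OF gL] by simp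
    \<comment> \<open>For a second minimizer the inequality \<open>le\<close> integrates to an
      equality. The gap \<open>F\<close> is nonnegative with integral 0, hence zero on every open
      subset of the ball where it is continuous.\<close>
    define F where "F x = \<bar>f x - g x\<bar> - ?S x * (f x - g x)" for x
    have F: "F integrable_on unit_ball" "?I F = 0" "\<And>x. F x \<ge> 0"
      unfolding F_def using absint[OF gL] sgnint[OF gL] le eq
      by (auto intro: integrable_diff simp: integral_diff)
    obtain G D where g_data: "harmonic_data unit_ball g G D" using L(2)[OF gL] by blast
    obtain H E where h_data: "harmonic_data unit_ball h H E" using L(2)[OF h] by blast
    have contfg: "continuous_on (unit_ball - {y}) (\<lambda>x. f x - g x)"
      using cont harmonic_data_continuous(1)[OF g_data]
      by (intro continuous_on_diff) (auto elim: continuous_on_subset)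
    \<comment> \<open>Both \<open>y\<close> and the sphere are left out: \<open>f\<close> is
      continuous only off \<open>y\<close>, and the sign function jumps at the sphere.\<close>
    have in0: "f x - g x \<ge> 0" if x: "norm x < r" "x \<noteq> y" for x
    proof -
      have "continuous_on (ball 0 r - {y}) (\<lambda>x. \<bar>f x - g x\<bar> - (f x - g x))"
        using r by (intro continuous_intros continuous_on_subset[OF contfg]) auto
      then have "continuous_on (ball 0 r - {y}) F"
        by (rule continuous_on_eq) (auto simp: F_def shell_sign_def)
      with x r have "F x = 0"
        by (intro integral_zero_imp_zero_on_open[OF _ _ _ F(1,2,3), of "ball 0 r - {y}"]) auto
      then show ?thesis using x by (auto simp: F_def shell_sign_def)
    qed
    have out0: "f x - g x \<le> 0" if x: "r < norm x" "norm x < 1" for x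
    proof -
      have "continuous_on (ball 0 1 - cball 0 r) (\<lambda>x. \<bar>f x - g x\<bar> + (f x - g x))"
        using r y by (intro continuous_intros continuous_on_subset[OF contfg]) auto
      then have "continuous_on (ball 0 1 - cball 0 r) F"
        by (rule continuous_on_eq) (auto simp: F_def shell_sign_def)
      with x r have "F x = 0"
        by (intro integral_zero_imp_zero_on_open[OF _ _ _ F(1,2,3), of "ball 0 1 - cball 0 r"]) auto
      then show ?thesis using x by (auto simp: F_def shell_sign_def)
    qed
    \<comment> \<open>The signs found on either side pass to the limit along the ray through
      \<open>x\<close>.\<close>
    have sphere0: "f x - g x = 0" if x: "norm x = r" for x
    proof -
      have "isCont (\<lambda>x. f x - g x) x"
        using contfg x r y by (subst (asm) continuous_on_eq_continuous_at) auto
      moreover have "(\<lambda>t. t *\<^sub>R x) \<midarrow>1\<rightarrow> x" by (auto intro!: tendsto_eq_intros)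
      ultimately have lim: "(\<lambda>t. f (t *\<^sub>R x) - g (t *\<^sub>R x)) \<midarrow>1\<rightarrow> f x - g x"
        by (rule isCont_tendsto_compose)
      have "\<forall>\<^sub>F t in at_left 1. f (t *\<^sub>R x) - g (t *\<^sub>R x) \<ge> 0"
      proof (rule eventually_at_leftI)
        \<comment> \<open>For \<open>t\<close> above this bound \<open>t *\<^sub>R x\<close> is
          farther from 0 than \<open>y\<close>, so the ray stays clear of \<open>y\<close>.\<close>
        show "norm y / r < 1" using y r by simp
        fix t assume t: "t \<in> {norm y / r <..< 1}"
        moreover have "0 \<le> norm y / r" using r by simp
        ultimately have "t > 0" by (meson greaterThanLessThan_iff le_less_trans)
        moreover have "norm y < t * r" using t r by (simp add: field_simps)
        ultimately show "f (t *\<^sub>R x) - g (t *\<^sub>R x) \<ge> 0" using t r x by (intro in0) auto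
      qed
      then have "f x - g x \<ge> 0"
        using lim by (intro tendsto_lowerbound[OF tendsto_mono[OF at_le[OF subset_UNIV] lim]]) auto
      moreover have "\<forall>\<^sub>F t in at_right 1. f (t *\<^sub>R x) - g (t *\<^sub>R x) \<le> 0"
      proof (rule eventually_at_rightI)
        show "1 < 1 / r" using r by simp
        show "f (t *\<^sub>R x) - g (t *\<^sub>R x) \<le> 0" if "t \<in> {1 <..< 1 / r}" for t
          using that r x by (intro out0) (auto simp: field_simps)
      qed
      then have "f x - g x \<le> 0"
        using lim by (intro tendsto_upperbound[OF tendsto_mono[OF at_le[OF subset_UNIV] lim]]) auto
      ultimately show ?thesis by simp
    qed
    have data: "harmonic_data unit_ball (\<lambda>x. g x - h x) (\<lambda>x. G x - H x) (\<lambda>x v. D x v - E x v)"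
      using g_data h_data by (rule harmonic_data_diff)
    have "g x - h x = 0" if "norm x = r" for x
    proof -
      have "x \<noteq> y" using that y by auto
      \<comment> \<open>On the sphere \<open>inner\<close> and \<open>outer\<close> both apply and
        give \<open>f x = h x\<close>.\<close>
      then show ?thesis using sphere0[OF that] inner[of x] outer[of x] that r by auto
    qed
    then have "g x - h x = 0" if "norm x < r" for x
      using harmonic_zero_on_sphere_imp_zero[OF data r(1,2)] that by blast
    then have "g x - h x = 0"
      using harmonic_zero_near_0_imp_zero[OF data r(1,2)] x by (metis mem_ball_0)
    then show ?thesis by simp
  qed
  then show ?thesis
    unfolding the_best_harmonic_approximant_def best_harmonic_approximant_def using f h best by blast
qed

section \<open>Integrability of the kernels\<close>

lemma exists_dyadic_shell:
  fixes d R :: real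
  assumes "0 < d" "d \<le> R"
  obtains k :: nat where "R / 2 ^ Suc k < d" "d \<le> R / 2 ^ k"
proof -
  have "(\<lambda>k. R / 2 ^ Suc k) \<longlonglongrightarrow> 0" by real_asymp
  then have "\<exists>k. R / 2 ^ Suc k < d"
    using order_tendstoD(2)[OF _ assms(1)] eventually_sequentially by (metis le_refl)
  define k where "k = (LEAST k. R / 2 ^ Suc k < d)"
  have 1: "R / 2 ^ Suc k < d" unfolding k_def by (rule LeastI_ex) fact
  have "d \<le> R / 2 ^ k"
  proof (cases k)
    case (Suc j)
    then have "\<not> R / 2 ^ Suc j < d" using not_less_Least[of j "\<lambda>k. R / 2 ^ Suc k < d"] k_def by simp
    then show ?thesis using Suc by simp
  qed (use assms in auto)
  with 1 show ?thesis by (rule that)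
qed

text \<open>Dyadic domination: on the shell R / 2^(k+1) < |x - y| \<le> R / 2^k the kernel is at
  most \<open>c k\<close>, so it is bounded by the sum of \<open>c k\<close> times the indicator of
  \<open>B k\<close>. The integrals of these terms form a geometric series, convergent because
  \<open>m\<close> is below the dimension.\<close>

lemma integrable_inverse_norm_power:
  fixes y :: "'a::euclidean_space"
  assumes m: "m < DIM('a)" and R: "R > 0"
  shows "(\<lambda>x. 1 / norm (x - y) ^ m) absolutely_integrable_on cball y R"
proof -
  define c where "c k = (2 ^ Suc k / R) ^ m" for k :: nat
  define B where "B k = cball y (R / 2 ^ k)" for k :: nat
  define V where "V = unit_ball_vol (real DIM('a))"
  have V: "V \<ge> 0" by (simp add: V_def)
  have c: "c k \<ge> 0" for k using R by (simp add: c_def)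
  have bound: "indicator (cball y R) x * ennreal (1 / norm (x - y) ^ m) \<le> (\<Sum>k. ennreal (c k) * indicator (B k) x)" for x
  proof (cases "x \<in> cball y R")
    case True
    have le: "(\<lambda>k. ennreal (c k) * indicator (B k) x) k \<le> (\<Sum>k. ennreal (c k) * indicator (B k) x)" for k
      using sum_le_suminf[OF summableI, of "{k}" "\<lambda>k. ennreal (c k) * indicator (B k) x"]
      by (simp del: sum_mult_indicator)
    show ?thesis
    proof (cases "x = y")
      case True
      \<comment> \<open>At the centre, division by zero gives 0 if \<open>m > 0\<close>, and
        \<open>m = 0\<close> gives 1; both are at most \<open>c 0\<close>.\<close>
      have "ennreal (1 / norm (x - y) ^ m) \<le> ennreal (c 0) * indicator (B 0) x"
        using True R by (cases m) (auto simp: c_def B_def)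
      then show ?thesis using le[of 0] True R by (auto intro: order_trans)
    next
      case False
      then obtain k where k: "R / 2 ^ Suc k < norm (x - y)" "norm (x - y) \<le> R / 2 ^ k"
        using exists_dyadic_shell[of "norm (x - y)" R] True by (auto simp: dist_norm norm_minus_commute)
      have "1 / norm (x - y) ^ m \<le> 1 / (R / 2 ^ Suc k) ^ m"
        using k R by (intro divide_left_mono power_mono) (auto intro!: mult_pos_pos zero_less_power simp: False)
      also have "\<dots> = c k" by (simp add: c_def power_divide)
      finally have "ennreal (1 / norm (x - y) ^ m) \<le> ennreal (c k) * indicator (B k) x"
        using k by (auto simp: B_def dist_norm norm_minus_commute intro!: ennreal_leI)
      then show ?thesis using le[of k] True by (auto intro: order_trans)
    qed
  qed simp
  \<comment> \<open>In dimension n the ratio is 2^(m - n): a factor 2^m from \<open>c\<close> and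
    2^(-n) from the volume.\<close>
  have "summable (\<lambda>k. (2 / R) ^ m * V * R ^ DIM('a) * (1 / 2 ^ (DIM('a) - m)) ^ k)"
    using m by (intro summable_mult summable_geometric) (simp add: one_less_power)
  also have "(\<lambda>k. (2 / R) ^ m * V * R ^ DIM('a) * (1 / 2 ^ (DIM('a) - m)) ^ k) = (\<lambda>k. c k * (V * (R / 2 ^ k) ^ DIM('a)))"
  proof
    fix k
    obtain j where j: "DIM('a) = m + j" using le_Suc_ex[OF less_imp_le[OF m]] ..
    show "(2 / R) ^ m * V * R ^ DIM('a) * (1 / 2 ^ (DIM('a) - m)) ^ k = c k * (V * (R / 2 ^ k) ^ DIM('a))"
    proof -
      define p :: real where "p = 2 ^ k"
      have p: "p > 0" by (simp add: p_def)
      have q: "(1 / 2 ^ j) ^ k = 1 / p ^ j"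
        by (simp add: p_def power_divide power_mult[symmetric] mult.commute)
      have e: "(2 ^ Suc k / R) ^ m = (2 / R) ^ m * p ^ m"
        unfolding p_def power_mult_distrib[symmetric] by simp
      show ?thesis
        unfolding c_def e j diff_add_inverse q p_def[symmetric] using p by (simp add: power_add power_divide)
    qed
  qed
  finally have sum: "summable (\<lambda>k. c k * (V * (R / 2 ^ k) ^ DIM('a)))" .
  have "(\<integral>\<^sup>+x. indicator (cball y R) x * ennreal (1 / norm (x - y) ^ m) \<partial>lborel)
      \<le> (\<integral>\<^sup>+x. (\<Sum>k. ennreal (c k) * indicator (B k) x) \<partial>lborel)"
    by (intro nn_integral_mono bound)
  also have "\<dots> = (\<Sum>k. \<integral>\<^sup>+x. ennreal (c k) * indicator (B k) x \<partial>lborel)"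
    by (intro nn_integral_suminf borel_measurable_times_ennreal borel_measurable_const borel_measurable_indicator)
      (simp add: B_def)
  also have "\<dots> = (\<Sum>k. ennreal (c k * (V * (R / 2 ^ k) ^ DIM('a))))"
    using R V c by (simp add: B_def nn_integral_cmult_indicator emeasure_cball V_def[symmetric] ennreal_mult del: nn_integral_indicator)
  also have "\<dots> < \<infinity>"
    unfolding infinity_ennreal_def less_top[symmetric]
    by (rule ennreal_suminf_neq_top[OF sum]) (use c V R in simp)
  finally have fin: "(\<integral>\<^sup>+x. indicator (cball y R) x * ennreal (1 / norm (x - y) ^ m) \<partial>lborel) < \<infinity>" .
  have "integrable lborel (\<lambda>x. indicator (cball y R) x *\<^sub>R (1 / norm (x - y) ^ m))"
  proof (rule integrableI_nonneg)
    have "(\<integral>\<^sup>+x. ennreal (indicator (cball y R) x *\<^sub>R (1 / norm (x - y) ^ m)) \<partial>lborel)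
      = (\<integral>\<^sup>+x. indicator (cball y R) x * ennreal (1 / norm (x - y) ^ m) \<partial>lborel)"
      by (intro nn_integral_cong) (auto simp: indicator_def)
    then show "(\<integral>\<^sup>+x. ennreal (indicator (cball y R) x *\<^sub>R (1 / norm (x - y) ^ m)) \<partial>lborel) < \<infinity>" using fin by simp
    have [measurable]: "cball y R \<in> sets borel" by simp
    show "(\<lambda>x. indicator (cball y R) x *\<^sub>R (1 / norm (x - y) ^ m)) \<in> borel_measurable lborel"
      by measurable
  qed simp
  then show ?thesis unfolding set_integrable_def
    using integrable_completion borel_measurable_integrable by blast
qed

lemma absolutely_integrable_inverse_norm_power:
  fixes y :: "'a::euclidean_space"
  assumes "m < DIM('a)"
  shows "(\<lambda>x. 1 / norm (x - y) ^ m) absolutely_integrable_on ball 0 1"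
proof (rule set_integrable_subset)
  have "0 < 1 + norm y" using norm_ge_zero[of y] by linarith
  then show "(\<lambda>x. 1 / norm (x - y) ^ m) absolutely_integrable_on cball y (1 + norm y)"
    by (rule integrable_inverse_norm_power[OF assms])
  show "ball 0 1 \<subseteq> cball y (1 + norm y)"
  proof
    fix x :: 'a assume "x \<in> ball 0 1"
    then show "x \<in> cball y (1 + norm y)"
      using norm_triangle_ineq4[of y x] by (simp add: dist_norm)
  qed
qed auto

text \<open>For d = |x - y| > 0 one has |ln d| \<le> d + 1 / d; d is bounded on the ball, and 1 / d
  is integrable since the dimension exceeds 1.\<close>

lemma absolutely_integrable_ln_norm:
  fixes y :: "'a::euclidean_space"
  assumes "1 < DIM('a)" and c: "c > 0"
  shows "(\<lambda>x. ln (c * norm (x - y))) absolutely_integrable_on ball 0 1"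
proof (rule measurable_bounded_by_integrable_imp_absolutely_integrable)
  have "(\<lambda>x. ln (c * norm (x - y))) \<in> borel_measurable borel" by measurable
  then have "(\<lambda>x. ln (c * norm (x - y))) \<in> borel_measurable lebesgue"
    by (intro measurable_completion) simp
  then show "(\<lambda>x. ln (c * norm (x - y))) \<in> borel_measurable (lebesgue_on (ball 0 1))"
    by (rule measurable_restrict_space1)
  have "(\<lambda>x. 1 / norm (x - y) ^ 1) integrable_on ball 0 1"
    using absolutely_integrable_inverse_norm_power[of 1 y] assms by (intro set_lebesgue_integral_eq_integral(1)) auto
  then show "(\<lambda>x. 1 / norm (x - y) ^ 1 + (\<bar>ln c\<bar> + 1 + norm y)) integrable_on ball 0 1"
    by (intro integrable_add integrable_on_const) auto
  fix x :: 'a assume x: "x \<in> ball 0 1"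
  show "norm (ln (c * norm (x - y))) \<le> 1 / norm (x - y) ^ 1 + (\<bar>ln c\<bar> + 1 + norm y)"
  proof (cases "x = y")
    case False
    define d where "d = norm (x - y)"
    have d: "d > 0" "d \<le> 1 + norm y" using False x norm_triangle_ineq4[of x y] by (auto simp: d_def)
    have "ln d \<le> d" using d ln_bound by blast
    moreover have "- ln d \<le> 1 / d" using d ln_bound[of "1 / d"] by (simp add: ln_div)
    moreover have "ln (c * d) = ln c + ln d" using c d by (simp add: ln_mult)
    moreover have "0 < 1 / d" using d by simp
    ultimately show ?thesis using d unfolding d_def[symmetric] real_norm_def power_one_right by linarith
  qed simp
qed auto

section \<open>Harmonicity of the Newtonian and logarithmic potentials\<close>

lemma harmonic_data_imp_harmonic_on:
  fixes u :: "real^'n \<Rightarrow> real"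
  assumes "harmonic_data S u g D"
  shows "harmonic_on S u"
proof -
  note d = harmonic_dataD[OF assms]
  have "continuous_on S (\<lambda>x. matrix (D x))"
    unfolding matrix_def
    by (intro continuous_on_vec_lambda continuous_on_component d(4)) (auto simp: Basis_real_vec)
  moreover have "(g has_derivative (\<lambda>v. matrix (D x) *v v)) (at x)" "trace (matrix (D x)) = 0" if "x \<in> S" for x
  proof -
    have "(*v) (matrix (D x)) = D x"
      using matrix_vector_mul(2)[OF d(6)[OF that]] .
    then show "(g has_derivative (\<lambda>v. matrix (D x) *v v)) (at x)" "trace (matrix (D x)) = 0"
      using d(3,5)[OF that] unfolding lin_trace_matrix[symmetric] by simp_all
  qed
  ultimately show ?thesis unfolding harmonic_on_def using d(1,2)
    by (intro conjI exI[of _ g] exI[of _ "\<lambda>x. matrix (D x)"] ballI)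
qed

text \<open>The derivative at nonzero \<open>x\<close> of the field x / |x|^n in dimension n, which
  up to a constant is the gradient of |x|^(2-n) for n \<ge> 3 and of ln |x| for n = 2.\<close>

definition newton_field_deriv :: "'a::euclidean_space \<Rightarrow> 'a \<Rightarrow> 'a" where
  "newton_field_deriv x v = (1 / norm x ^ DIM('a)) *\<^sub>R v - (DIM('a) / norm x ^ (DIM('a) + 2)) *\<^sub>R ((x \<bullet> v) *\<^sub>R x)"

lemma has_derivative_norm_compose:
  fixes x a :: "'a::real_inner"
  assumes "(f has_real_derivative f') (at (norm (x - a)))" "x \<noteq> a"
  shows "((\<lambda>x. f (norm (x - a))) has_derivative (\<lambda>v. ((x - a) \<bullet> v) * (f' / norm (x - a)))) (at x)"
proof -
  have "((\<lambda>x. norm (x - a)) has_derivative (\<lambda>v. v \<bullet> sgn (x - a))) (at x)"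
    by (rule has_derivative_compose[of "\<lambda>x. x - a" "\<lambda>v. v", OF _ has_derivative_norm])
       (use assms(2) in \<open>auto intro!: derivative_eq_intros\<close>)
  from DERIV_compose_FDERIV[OF assms(1) this]
  show ?thesis by (rule has_derivative_eq_rhs) (simp add: fun_eq_iff sgn_div_norm inner_commute divide_inverse mult_ac)
qed

lemma DERIV_inverse_power:
  fixes t :: real
  assumes "t \<noteq> 0"
  shows "((\<lambda>t. 1 / t ^ m) has_real_derivative - real m / t ^ (m + 1)) (at t)"
proof (cases m)
  case (Suc k)
  have "((\<lambda>t. 1 / t ^ m) has_real_derivative (0 * t ^ m - 1 * (real m * t ^ (m - Suc 0))) / (t ^ m * t ^ m)) (at t)"
    by (rule DERIV_divide[OF DERIV_const DERIV_pow]) (use assms in simp)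
  then show ?thesis by (rule DERIV_cong) (use assms Suc in \<open>simp add: field_simps\<close>)
qed simp

lemma newton_field_has_derivative:
  fixes x :: "'a::euclidean_space"
  assumes "x \<noteq> 0"
  shows "((\<lambda>x. (1 / norm x ^ DIM('a)) *\<^sub>R x) has_derivative newton_field_deriv x) (at x)"
proof -
  have "((\<lambda>t. 1 / t ^ DIM('a)) has_real_derivative - real DIM('a) / norm x ^ (DIM('a) + 1)) (at (norm x))"
    using assms by (intro DERIV_inverse_power) simp
  from has_derivative_norm_compose[where a=0, simplified, OF this assms]
  have "((\<lambda>x. 1 / norm x ^ DIM('a)) has_derivative (\<lambda>v. (x \<bullet> v) * (- real DIM('a) / norm x ^ (DIM('a) + 2)))) (at x)"
    by (simp add: field_simps)
  from has_derivative_scaleR[OF this has_derivative_ident]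
  show ?thesis unfolding newton_field_deriv_def by (rule has_derivative_eq_rhs) (simp add: fun_eq_iff mult.commute)
qed

text \<open>The identity part has trace n / |x|^n and the rank-one part n |x|^2 / |x|^(n+2), which
  is the same.\<close>

lemma lin_trace_newton_field_deriv: "x \<noteq> 0 \<Longrightarrow> lin_trace (newton_field_deriv x) = 0"
  unfolding newton_field_deriv_def 
  by (simp add: lin_trace_diff lin_trace_scaleR lin_trace_rank_one power2_norm_eq_inner[symmetric] power2_eq_square 
      del: scaleR_scaleR)
     (simp add: lin_trace_def)

text \<open>Both potentials have a multiple of this field as gradient, so the Laplacian is checked
  once for the two.\<close>

lemma harmonic_data_newton_field:
  fixes a :: "'a::euclidean_space"
  assumes S: "open S" "a \<notin> S"
    and u: "\<And>x. x \<noteq> a \<Longrightarrow> (u has_derivative (\<lambda>v. (c / norm (x - a) ^ DIM('a)) * ((x - a) \<bullet> v))) (at x)"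
  shows "harmonic_data S u (\<lambda>x. c *\<^sub>R ((1 / norm (x - a) ^ DIM('a)) *\<^sub>R (x - a)))
           (\<lambda>x v. c *\<^sub>R newton_field_deriv (x - a) v)"
  unfolding harmonic_data_def
proof (intro conjI ballI)
  fix x assume "x \<in> S"
  then have x: "x \<noteq> a" using S by auto
  show "(u has_derivative (\<bullet>) (c *\<^sub>R ((1 / norm (x - a) ^ DIM('a)) *\<^sub>R (x - a)))) (at x)"
    by (rule has_derivative_eq_rhs[OF u[OF x]]) (simp add: fun_eq_iff)
  show "((\<lambda>x. c *\<^sub>R ((1 / norm (x - a) ^ DIM('a)) *\<^sub>R (x - a))) has_derivative
      (\<lambda>v. c *\<^sub>R newton_field_deriv (x - a) v)) (at x)"
    using x by (intro has_derivative_scaleR_right has_derivative_compose[of "\<lambda>x. x - a" "\<lambda>v. v", OF _ newton_field_has_derivative])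
      (auto intro!: derivative_eq_intros)
  show "lin_trace (\<lambda>v. c *\<^sub>R newton_field_deriv (x - a) v) = 0"
    using x by (simp add: lin_trace_scaleR lin_trace_newton_field_deriv)
next
  fix b :: 'a
  show "continuous_on S (\<lambda>x. c *\<^sub>R newton_field_deriv (x - a) b)"
    unfolding newton_field_deriv_def using S by (intro continuous_intros) auto
qed (use S in auto)

lemma harmonic_data_newton_potential:
  fixes a :: "'a::euclidean_space"
  assumes S: "open S" "a \<notin> S" and n: "DIM('a) \<ge> 3"
  obtains g D where "harmonic_data S (\<lambda>x. c * (1 / norm (x - a) ^ (DIM('a) - 2))) g D"
proof -
  define m where "m = DIM('a) - 2"
  have m: "DIM('a) = m + 2" "m > 0" using n by (auto simp: m_def)
  have "((\<lambda>x. c * (1 / norm (x - a) ^ (DIM('a) - 2))) has_derivative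
    (\<lambda>v. ((- c * m) / norm (x - a) ^ DIM('a)) * ((x - a) \<bullet> v))) (at x)" if "x \<noteq> a" for x
  proof -
    \<comment> \<open>The gradient of the norm brings one more division by |x - a|, raising the
      exponent m + 1 to m + 2 = n.\<close>
    have "((\<lambda>t. c * (1 / t ^ m)) has_real_derivative - c * m / norm (x - a) ^ (m + 1)) (at (norm (x - a)))"
      using DERIV_cmult[OF DERIV_inverse_power[of "norm (x - a)" m], of c] that by simp
    from has_derivative_norm_compose[OF this that] show ?thesis
      unfolding m_def[symmetric] by (rule has_derivative_eq_rhs) (simp add: fun_eq_iff m mult_ac)
  qed
  from harmonic_data_newton_field[OF S this] show ?thesis by (rule that)
qed

lemma harmonic_data_log_potential:
  fixes a :: "'a::euclidean_space"
  assumes S: "open S" "a \<notin> S" and n: "DIM('a) = 2" and c: "c > 0"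
  obtains g D where "harmonic_data S (\<lambda>x. ln (c * norm (x - a))) g D"
proof -
  have "((\<lambda>x. ln (c * norm (x - a))) has_derivative (\<lambda>v. (1 / norm (x - a) ^ DIM('a)) * ((x - a) \<bullet> v))) (at x)" 
    if "x \<noteq> a" for x
  proof -
    have "((\<lambda>t. ln (c * t)) has_real_derivative 1 / norm (x - a)) (at (norm (x - a)))"
      using that c by (auto intro!: derivative_eq_intros)
    from has_derivative_norm_compose[OF this that] show ?thesis
      by (rule has_derivative_eq_rhs) (simp add: fun_eq_iff n power2_eq_square)
  qed
  from harmonic_data_newton_field[OF S this] show ?thesis by (rule that)
qed

section \<open>Comparing the distances to a point and to its reflection\<close>

lemma sphere_reflection_dist:
  fixes x y :: "real^'n"
  assumes "y \<noteq> 0" "r > 0"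
  shows "(norm y / r * norm (x - sphere_reflection r y))\<^sup>2 - (norm (x - y))\<^sup>2
       = ((norm x)\<^sup>2 - r\<^sup>2) * ((norm y)\<^sup>2 / r\<^sup>2 - 1)"
proof -
  \<comment> \<open>The squared factor |y|^2 / r^2 is 1 / q, so the mixed terms in x \<bullet> y of
    the two squares cancel; what remains factors.\<close>
  define q where "q = r\<^sup>2 / (norm y)\<^sup>2"
  have q: "q \<noteq> 0" "r\<^sup>2 = q * (norm y)\<^sup>2" "norm y \<noteq> 0" using assms by (auto simp: q_def)
  have A: "(norm (x - q *\<^sub>R y))\<^sup>2 = (norm x)\<^sup>2 - 2 * q * (x \<bullet> y) + q\<^sup>2 * (norm y)\<^sup>2"
    unfolding power2_norm_eq_inner by (simp add: inner_diff inner_commute power2_eq_square algebra_simps)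
  have B: "(norm (x - y))\<^sup>2 = (norm x)\<^sup>2 - 2 * (x \<bullet> y) + (norm y)\<^sup>2"
    by (simp add: power2_norm_eq_inner inner_diff inner_commute algebra_simps)
  show ?thesis
    unfolding sphere_reflection_def q_def[symmetric] power_mult_distrib power_divide A B
    unfolding q(2)
    using q(1,3) by (simp add: field_simps power2_eq_square)
qed

text \<open>The second factor in \<open>sphere_reflection_dist\<close> is nonpositive for |y| < r,
  so |x| against r alone decides the comparison. This is the source of the sign of f - h.\<close>

lemma sphere_reflection_dist_le:
  fixes x y :: "real^'n"
  assumes y: "y \<noteq> 0" "norm y < r"
  shows "norm x \<le> r \<Longrightarrow> norm (x - y) \<le> norm y / r * norm (x - sphere_reflection r y)"
    and "r \<le> norm x \<Longrightarrow> norm y / r * norm (x - sphere_reflection r y) \<le> norm (x - y)"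
proof -
  have r: "r > 0" using y norm_ge_zero[of y] by linarith
  have neg: "(norm y)\<^sup>2 / r\<^sup>2 - 1 \<le> 0" using y r by (simp add: power_mono)
  note eq = sphere_reflection_dist[OF y(1) r, of x]
  show "norm (x - y) \<le> norm y / r * norm (x - sphere_reflection r y)" if "norm x \<le> r"
  proof (rule power2_le_imp_le)
    have "(norm x)\<^sup>2 - r\<^sup>2 \<le> 0" using that by (simp add: power_mono)
    then show "(norm (x - y))\<^sup>2 \<le> (norm y / r * norm (x - sphere_reflection r y))\<^sup>2"
      using mult_nonpos_nonpos[OF _ neg] eq by fastforce
  qed (use r in simp)
  show "norm y / r * norm (x - sphere_reflection r y) \<le> norm (x - y)" if "r \<le> norm x"
  proof (rule power2_le_imp_le)
    have "(norm x)\<^sup>2 - r\<^sup>2 \<ge> 0" using that r by (simp add: power_mono)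
    then show "(norm y / r * norm (x - sphere_reflection r y))\<^sup>2 \<le> (norm (x - y))\<^sup>2"
      using mult_nonneg_nonpos[OF _ neg] eq by fastforce
  qed simp
qed

text \<open>The reflected point has norm r^2 / |y| \<ge> 1. Here the bound on |y| keeps the pole of
  the approximant out of the open ball.\<close>

lemma sphere_reflection_outside:
  fixes y :: "real^'n"
  assumes "y \<noteq> 0" "norm y \<le> r\<^sup>2"
  shows "sphere_reflection r y \<notin> ball 0 1"
  using assms by (simp add: sphere_reflection_def power2_eq_square field_simps)

section \<open>The radius \<open>rho\<close> and the two kernels\<close>

lemma rho_bounds:
  assumes "n \<ge> 1"
  shows "0 < rho n" "rho n < 1" "rho n ^ n = 1 / 2"
proof -
  show "0 < rho n" "rho n < 1" using assms powr_less_mono[of "- 1 / real n" 0 2] by (auto simp: rho_def)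
  have "rho n ^ n = 2 powr (- 1 / real n * real n)"
    by (simp add: rho_def powr_power)
  then show "rho n ^ n = 1 / 2" using assms by (simp add: powr_minus)
qed

lemma rho_2: "rho 2 = 1 / sqrt 2"
  by (simp add: rho_def powr_minus_divide powr_half_sqrt)

text \<open>The criterion wants \<open>f\<close> above \<open>h\<close> inside the small sphere,
  while the logarithm tends to minus infinity at its pole. Negation fits it to the criterion and
  preserves both the space of competitors and the norm.\<close>

lemma the_best_harmonic_approximant_uminus:
  fixes f h :: "real^'n \<Rightarrow> real"
  assumes "the_best_harmonic_approximant (\<lambda>x. - f x) (\<lambda>x. - h x)"
  shows "the_best_harmonic_approximant f h"
proof -
  have abs: "(\<lambda>x. - u x) absolutely_integrable_on unit_ball \<longleftrightarrow> u absolutely_integrable_on unit_ball" for u :: "real^'n \<Rightarrow> real"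
    by (simp add: absolutely_integrable_on_def integrable_neg_iff)
  have harm: "harmonic_on unit_ball (\<lambda>x. - u x)" if u: "harmonic_on unit_ball u" for u :: "real^'n \<Rightarrow> real"
  proof -
    obtain g D where "harmonic_data unit_ball u g D" using harmonic_on_imp_data[OF u] .
    from harmonic_data_diff[OF harmonic_data_const[of 0] this] show ?thesis
      using harmonic_data_imp_harmonic_on by fastforce
  qed
  have L: "(\<lambda>x. - u x) \<in> L1_harmonic \<longleftrightarrow> u \<in> L1_harmonic" for u :: "real^'n \<Rightarrow> real"
    using harm[of u] harm[of "\<lambda>x. - u x"] by (auto simp: L1_harmonic_def abs)
  have N: "L1_norm (\<lambda>x. - f x - - u x) = L1_norm (\<lambda>x. f x - u x)" for u
    unfolding L1_norm_def by (simp add: abs_minus_commute)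
  have best: "best_harmonic_approximant (\<lambda>x. - f x) (\<lambda>x. - u x) \<longleftrightarrow> best_harmonic_approximant f u" for u
  proof -
    \<comment> \<open>Competitors are reindexed by negation, which maps \<open>L1_harmonic\<close>
      onto itself.\<close>
    have "(\<forall>g\<in>L1_harmonic. L1_norm (\<lambda>x. - f x - - u x) \<le> L1_norm (\<lambda>x. - f x - g x)) \<longleftrightarrow>
          (\<forall>g\<in>L1_harmonic. L1_norm (\<lambda>x. - f x - - u x) \<le> L1_norm (\<lambda>x. - f x - - g x))"
    proof safe
      fix g :: "real^'n \<Rightarrow> real" assume a: "\<forall>g\<in>L1_harmonic. L1_norm (\<lambda>x. - f x - - u x) \<le> L1_norm (\<lambda>x. - f x - - g x)"
        and g: "g \<in> L1_harmonic"
      show "L1_norm (\<lambda>x. - f x - - u x) \<le> L1_norm (\<lambda>x. - f x - g x)"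
        using a[rule_format, of "\<lambda>x. - g x"] g L[of g] by (simp only: minus_minus)
    qed (metis L)
    then show ?thesis unfolding best_harmonic_approximant_def abs L N by blast
  qed
  show ?thesis unfolding the_best_harmonic_approximant_def
  proof (intro conjI allI impI ballI)
    show "best_harmonic_approximant f h" using assms best unfolding the_best_harmonic_approximant_def by blast
    show "g x = h x" if "best_harmonic_approximant f g" "x \<in> unit_ball" for g x
      using assms best[of g] that unfolding the_best_harmonic_approximant_def by fastforce
  qed
qed

lemma const_L1_harmonic: "(\<lambda>x::real^'n. c) \<in> L1_harmonic"
  using harmonic_data_imp_harmonic_on[OF harmonic_data_const, where 'n='n]
  by (auto simp: L1_harmonic_def intro!: absolutely_integrable_on_const)

text \<open>\<open>K\<close> is the quantity compared with |x - y|: for nonzero y it will be |y| /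
  rho times the distance to the reflected point, for y = 0 the constant rho. Both cases thus share
  one argument.\<close>

lemma best_approximant_newton:
  fixes y :: "real^'n" and K :: "real^'n \<Rightarrow> real"
  assumes n: "CARD('n) \<ge> 3" and y: "norm y < rho CARD('n)"
    and h: "(\<lambda>x. 1 / K x ^ (CARD('n) - 2)) \<in> L1_harmonic"
    and inner: "\<And>x. norm x \<le> rho CARD('n) \<Longrightarrow> norm (x - y) \<le> K x"
    and outer: "\<And>x. rho CARD('n) \<le> norm x \<Longrightarrow> norm x < 1 \<Longrightarrow> 0 < K x \<and> K x \<le> norm (x - y)"
  shows "the_best_harmonic_approximant (\<lambda>x. 1 / norm (x - y) ^ (CARD('n) - 2)) (\<lambda>x. 1 / K x ^ (CARD('n) - 2))"
proof (rule the_best_harmonic_approximantI[OF _ h _ _ _ y])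
  show "(\<lambda>x. 1 / norm (x - y) ^ (CARD('n) - 2)) absolutely_integrable_on unit_ball"
    using n by (intro absolutely_integrable_inverse_norm_power) simp
  show "continuous_on (unit_ball - {y}) (\<lambda>x. 1 / norm (x - y) ^ (CARD('n) - 2))"
    by (intro continuous_intros) auto
  show "1 / K x ^ (CARD('n) - 2) \<le> 1 / norm (x - y) ^ (CARD('n) - 2)" if "x \<noteq> y" "norm x \<le> rho CARD('n)" for x
  proof -
    have "0 < norm (x - y)" using that(1) by simp
    moreover from this have "0 < K x" using inner[OF that(2)] by linarith
    ultimately show ?thesis
      using inner[OF that(2)] by (intro divide_left_mono power_mono mult_pos_pos zero_less_power) auto
  qed
  show "1 / norm (x - y) ^ (CARD('n) - 2) \<le> 1 / K x ^ (CARD('n) - 2)" if "rho CARD('n) \<le> norm x" "norm x < 1" for x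
    using outer[OF that] by (intro divide_left_mono power_mono mult_pos_pos zero_less_power) auto
qed (use rho_bounds[of "CARD('n)"] n in auto)

lemma best_approximant_log:
  fixes y :: "real^2" and K :: "real^2 \<Rightarrow> real"
  assumes y: "norm y < rho 2"
    and h: "(\<lambda>x. ln (K x)) \<in> L1_harmonic"
    and inner: "\<And>x. norm x \<le> rho 2 \<Longrightarrow> norm (x - y) \<le> K x"
    and outer: "\<And>x. rho 2 \<le> norm x \<Longrightarrow> norm x < 1 \<Longrightarrow> 0 < K x \<and> K x \<le> norm (x - y)"
  shows "the_best_harmonic_approximant (\<lambda>x. ln (norm (x - y))) (\<lambda>x. ln (K x))"
proof (rule the_best_harmonic_approximant_uminus, rule the_best_harmonic_approximantI[where r = "rho 2" and y = y])
  show "(\<lambda>x. - ln (norm (x - y))) absolutely_integrable_on unit_ball"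
    using absolutely_integrable_ln_norm[of 1 y] by (simp add: absolutely_integrable_on_def integrable_neg_iff)
  show "(\<lambda>x. - ln (K x)) \<in> L1_harmonic"
  proof -
    have hL: "harmonic_on unit_ball (\<lambda>x. ln (K x))" "(\<lambda>x. ln (K x)) absolutely_integrable_on unit_ball"
      using h by (auto simp: L1_harmonic_def)
    obtain g D where "harmonic_data unit_ball (\<lambda>x. ln (K x)) g D" using harmonic_on_imp_data[OF hL(1)] .
    from harmonic_data_diff[OF harmonic_data_const[of 0] this] show ?thesis
      using harmonic_data_imp_harmonic_on hL(2) by (fastforce simp: L1_harmonic_def absolutely_integrable_on_def integrable_neg_iff)
  qed
  show "continuous_on (unit_ball - {y}) (\<lambda>x. - ln (norm (x - y)))"
    by (intro continuous_intros) auto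
  show "- ln (K x) \<le> - ln (norm (x - y))" if "x \<noteq> y" "norm x \<le> rho 2" for x
  proof -
    have "0 < norm (x - y)" using that(1) by simp
    from ln_mono[OF inner[OF that(2)] this] show ?thesis by simp
  qed
  show "- ln (norm (x - y)) \<le> - ln (K x)" if "rho 2 \<le> norm x" "norm x < 1" for x
    using ln_mono[of "K x" "norm (x - y)"] outer[OF that] by auto
qed (use rho_bounds[of 2] y in auto)

theorem theorem7p1:
  shows
    "(CARD('n::finite) \<ge> 3 \<longrightarrow>
       (\<forall>y :: real^'n. 0 < norm y \<and> norm y \<le> (rho CARD('n))\<^sup>2 \<longrightarrow>
          the_best_harmonic_approximant
            (\<lambda>x. 1 / norm (x - y) ^ (CARD('n) - 2))
            (\<lambda>x. (rho CARD('n) / norm y) ^ (CARD('n) - 2) *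
                 (1 / norm (x - rho_reflection y) ^ (CARD('n) - 2)))))
     \<and> (\<forall>y :: real^2. 0 < norm y \<and> norm y \<le> 1 / 2 \<longrightarrow>
          the_best_harmonic_approximant
            (\<lambda>x. ln (norm (x - y)))
            (\<lambda>x. ln (sqrt 2 * norm y * norm (x - rho_reflection y))))
     \<and> (CARD('n) \<ge> 3 \<longrightarrow>
          the_best_harmonic_approximant
            (\<lambda>x :: real^'n. 1 / norm x ^ (CARD('n) - 2))
            (\<lambda>x. 1 / rho CARD('n) ^ (CARD('n) - 2)))
     \<and> the_best_harmonic_approximant
          (\<lambda>x :: real^2. ln (norm x))
          (\<lambda>x. ln (1 / sqrt 2))"
proof (intro conjI impI allI)
  fix y :: "real^'n"
  assume n: "CARD('n) \<ge> 3" and y: "0 < norm y \<and> norm y \<le> (rho CARD('n))\<^sup>2"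
  let ?r = "rho CARD('n)" and ?m = "CARD('n) - 2"
  have r: "0 < ?r" "?r < 1" using rho_bounds n by auto
  \<comment> \<open>|y| \<le> rho^2 < rho because rho < 1, so the pole of f lies in the inner
    ball.\<close>
  then have yr: "norm y < ?r" using y mult_strict_right_mono[OF r(2) r(1)] unfolding power2_eq_square by linarith
  have y0: "y \<noteq> 0" using y by auto
  have out: "rho_reflection y \<notin> unit_ball" using sphere_reflection_outside y y0 by blast
  have eq: "(?r / norm y) ^ ?m * (1 / norm (x - rho_reflection y) ^ ?m) = 
      1 / (norm y / ?r * norm (x - rho_reflection y)) ^ ?m" for x
    by (simp add: power_mult_distrib power_divide)
  have "(\<lambda>x. (?r / norm y) ^ ?m * (1 / norm (x - rho_reflection y) ^ ?m)) \<in> L1_harmonic"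
    unfolding L1_harmonic_def mem_Collect_eq
  proof
    obtain g D where "harmonic_data unit_ball (\<lambda>x. (?r / norm y) ^ ?m * (1 / norm (x - rho_reflection y) ^ (DIM(real^'n) - 2))) g D"
      using harmonic_data_newton_potential[OF open_ball out] n by auto
    then show "harmonic_on unit_ball (\<lambda>x. (?r / norm y) ^ ?m * (1 / norm (x - rho_reflection y) ^ ?m))"
      using harmonic_data_imp_harmonic_on by simp
    \<comment> \<open>If |y| = rho^2, the reflected point lies on the unit sphere and the
      approximant is unbounded on the ball, so integrability rests on the kernel estimate.\<close>
    show "(\<lambda>x. (?r / norm y) ^ ?m * (1 / norm (x - rho_reflection y) ^ ?m)) absolutely_integrable_on unit_ball"
      using n by (intro set_integrable_mult_right absolutely_integrable_inverse_norm_power) simp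
  qed
  then show "the_best_harmonic_approximant (\<lambda>x. 1 / norm (x - y) ^ ?m)
        (\<lambda>x. (?r / norm y) ^ ?m * (1 / norm (x - rho_reflection y) ^ ?m))"
    unfolding eq
  proof (rule best_approximant_newton[OF n yr])
    show "0 < norm y / ?r * norm (x - rho_reflection y) \<and> norm y / ?r * norm (x - rho_reflection y) \<le> norm (x - y)"
      if "?r \<le> norm x" "norm x < 1" for x
    proof -
      have "x \<noteq> rho_reflection y" using out that by auto
      then show ?thesis
        using sphere_reflection_dist_le(2)[OF y0 yr that(1)] y r by (simp del: times_divide_eq_left)
    qed
  qed (rule sphere_reflection_dist_le(1)[OF y0 yr])
next
  fix y :: "real^2"
  assume y: "0 < norm y \<and> norm y \<le> 1 / 2"
  \<comment> \<open>In the plane the bound 1 / 2 on |y| is the square of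
    \<open>rho 2\<close>.\<close>
  have r: "0 < rho 2" "rho 2 < 1" "(rho 2)\<^sup>2 = 1 / 2" using rho_bounds[of 2] by auto
  then have yr: "norm y < rho 2" using y mult_strict_right_mono[OF r(2) r(1)] unfolding power2_eq_square by linarith
  have y0: "y \<noteq> 0" using y by auto
  have out: "rho_reflection y \<notin> unit_ball" using sphere_reflection_outside[OF y0, of "rho 2"] y r by simp
  have eq: "sqrt 2 * norm y = norm y / rho 2" by (simp add: rho_2)
  have "(\<lambda>x. ln (norm y / rho 2 * norm (x - rho_reflection y))) \<in> L1_harmonic"
    unfolding L1_harmonic_def mem_Collect_eq
  proof
    obtain g D where "harmonic_data unit_ball (\<lambda>x. ln (norm y / rho 2 * norm (x - rho_reflection y))) g D"
      using harmonic_data_log_potential[OF open_ball out, of "norm y / rho 2"] y r by auto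
    then show "harmonic_on unit_ball (\<lambda>x. ln (norm y / rho 2 * norm (x - rho_reflection y)))"
      by (rule harmonic_data_imp_harmonic_on)
    show "(\<lambda>x. ln (norm y / rho 2 * norm (x - rho_reflection y))) absolutely_integrable_on unit_ball"
      using y r by (intro absolutely_integrable_ln_norm) auto
  qed
  then show "the_best_harmonic_approximant (\<lambda>x. ln (norm (x - y))) (\<lambda>x. ln (sqrt 2 * norm y * norm (x - rho_reflection y)))"
    unfolding eq
  proof (rule best_approximant_log[OF yr])
    show "0 < norm y / rho 2 * norm (x - rho_reflection y) \<and> norm y / rho 2 * norm (x - rho_reflection y) \<le> norm (x - y)"
      if "rho 2 \<le> norm x" "norm x < 1" for x
    proof -
      have "x \<noteq> rho_reflection y" using out that by auto
      then show ?thesis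
        using sphere_reflection_dist_le(2)[OF y0 yr that(1)] y r by (simp del: times_divide_eq_left)
    qed
    show "norm (x - y) \<le> norm y / rho 2 * norm (x - rho_reflection y)" if "norm x \<le> rho 2" for x
      using sphere_reflection_dist_le(1)[OF y0 yr that] by simp
  qed
next
  assume n: "CARD('n) \<ge> 3"
  show "the_best_harmonic_approximant (\<lambda>x :: real^'n. 1 / norm x ^ (CARD('n) - 2)) (\<lambda>x. 1 / rho CARD('n) ^ (CARD('n) - 2))"
    \<comment> \<open>With y = 0 and \<open>K\<close> constant, the comparison inequalities are the
      conditions on |x| themselves.\<close>
    using best_approximant_newton[OF n, of 0 "\<lambda>_. rho CARD('n)"] rho_bounds[of "CARD('n)"] n
      const_L1_harmonic[where 'n='n]
    by simp
next
  show "the_best_harmonic_approximant (\<lambda>x :: real^2. ln (norm x)) (\<lambda>x. ln (1 / sqrt 2))"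
    using best_approximant_log[of 0 "\<lambda>_. rho 2"] rho_bounds[of 2] const_L1_harmonic[where 'n=2]
    by (simp add: rho_2[symmetric])
qed

end
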